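(* Ultimately periodic model checking and ultimately constant model checking of $\mathrm{LTL}(\sim)$ are logspace-reducible to $\mathbf{\Delta^2_0}$.
   Context: Let $\mathrm{AP}$ be a countably infinite set of atomic propositions. A trace is an infinite sequence $t=t(0)t(1)\cdots\in(\wp\mathrm{AP})^\omega$, and $t^i=t(i)t(i+1)\cdots$. A team is a (possibly empty) set $T$ of traces, and $T^i=\{t^i: t\in T\}$. Formulas of $\mathrm{LTL}(\sim)$ are given by $\varphi::=p\mid\neg\varphi\mid\varphi\wedge\varphi\mid\varphi\vee\varphi\mid\mathsf X\varphi\mid\mathsf F\varphi\mid\mathsf G\varphi\mid\varphi\,\mathsf U\,\varphi\mid\varphi\,\mathsf R\,\varphi\mid{\sim}\varphi$ with $p\in\mathrm{AP}$. Synchronous team semantics: $T\models p$ iff $p\in t(0)$ for all $t\in T$; $T\models\neg\varphi$ iff $\{t\}\not\models\varphi$ for all $t\in T$; $T\models\varphi\wedge\psi$ iff $T\models\varphi$ and $T\models\psi$; $T\models\varphi\vee\psi$ iff $T=S\cup U$ for some $S,U$ with $S\models\varphi$ and $U\models\psi$; $T\models\mathsf X\varphi$ iff $T^1\models\varphi$; $T\models\mathsf F\varphi$ iff $T^k\models\varphi$ for some $k\ge0$; $T\models\mathsf G\varphi$ iff $T^k\models\varphi$ for all $k\ge0$; $T\models\varphi\,\mathsf U\,\psi$ iff there is $k\ge0$ with $T^k\models\psi$ and $T^j\models\varphi$ for all $j<k$; $T\models\varphi\,\mathsf R\,\psi$ iff for all $k\ge0$, $T^k\models\psi$ or $T^j\models\varphi$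 for some $j<k$; $T\models{\sim}\varphi$ iff $T\not\models\varphi$. A finite Kripke structure is $K=(W,R,\eta,r)$ with $W$ finite nonempty, $R\subseteq W\times W$ serial, $\eta:W\to\wp\mathrm{AP}$ with finite labels, and root $r\in W$; a path is $\pi\in W^\omega$ with $\pi(0)=r$ and $(\pi(i),\pi(i+1))\in R$; it induces the trace $(\eta(\pi(i)))_{i\ge0}$; $T(K)$ is the team of all induced traces. A trace $t$ is ultimately periodic if there are $c,d>0$ with $t(n)=t(n+d)$ for all $n\ge c$, and ultimately constant if some suffix $t^i$ is constant. Ultimately periodic (resp. constant) model checking: the set of pairs $(K,\varphi)$, $K$ a finite Kripke structure, such that $T(K)\cap\mathcal C\models\varphi$, where $\mathcal C$ is the class of ultimately periodic (resp. ultimately constant) traces. $\mathbf{\Delta^2_0}$ denotes the set of closed formulas of second-order arithmetic (vocabulary $+,\times,0,1,=,\le$; first-order variables over $\mathbb N$, second-order variables of arity $n$ over subsets of $\mathbb N^n$) true in the standard model $\mathbb N$. *)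

theory Defs
  imports Complex_Main
begin

datatype ltl =
    Prop nat
  | Neg ltl
  | Conj ltl ltl
  | Disj ltl ltl
  | Next ltl
  | Fin ltl
  | Glob ltl
  | Until ltl ltl
  | Release ltl ltl
  | Tilde ltl

type_synonym trace = "nat \<Rightarrow> nat set"

definition suffix :: "trace \<Rightarrow> nat \<Rightarrow> trace" where
  "suffix t i = (\<lambda>n. t (i + n))"

definition team_suffix :: "trace set \<Rightarrow> nat \<Rightarrow> trace set" where
  "team_suffix T i = (\<lambda>t. suffix t i) ` T"

primrec tsat :: "trace set \<Rightarrow> ltl \<Rightarrow> bool" where
  "tsat T (Prop p) = (\<forall>t\<in>T. p \<in> t 0)"
| "tsat T (Neg \<phi>) = (\<forall>t\<in>T. \<not> tsat {t} \<phi>)"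
| "tsat T (Conj \<phi> \<psi>) = (tsat T \<phi> \<and> tsat T \<psi>)"
| "tsat T (Disj \<phi> \<psi>) = (\<exists>S U. T = S \<union> U \<and> tsat S \<phi> \<and> tsat U \<psi>)"
| "tsat T (Next \<phi>) = tsat (team_suffix T 1) \<phi>"
| "tsat T (Fin \<phi>) = (\<exists>k. tsat (team_suffix T k) \<phi>)"
| "tsat T (Glob \<phi>) = (\<forall>k. tsat (team_suffix T k) \<phi>)"
| "tsat T (Until \<phi> \<psi>) =
     (\<exists>k. tsat (team_suffix T k) \<psi> \<and> (\<forall>j<k. tsat (team_suffix T j) \<phi>))"
| "tsat T (Release \<phi> \<psi>) =
     (\<forall>k. tsat (team_suffix T k) \<psi> \<or> (\<exists>j<k. tsat (team_suffix T j) \<phi>))"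
| "tsat T (Tilde \<phi>) = (\<not> tsat T \<phi>)"

definition ult_periodic :: "trace \<Rightarrow> bool" where
  "ult_periodic t = (\<exists>c d. c > 0 \<and> d > 0 \<and> (\<forall>n\<ge>c. t n = t (n + d)))"

definition ult_constant :: "trace \<Rightarrow> bool" where
  "ult_constant t = (\<exists>i. \<forall>n. suffix t i n = suffix t i 0)"

text \<open>Worlds are \<open>{0..<nW}\<close> (every finite Kripke structure is isomorphic to one of this form).\<close>

record kripke =
  nW  :: nat
  rel :: "(nat \<times> nat) set"
  lab :: "nat \<Rightarrow> nat set"
  rt  :: nat

definition wf_kripke :: "kripke \<Rightarrow> bool" where
  "wf_kripke K \<longleftrightarrow> nW K > 0 \<and> rel K \<subseteq> {..<nW K} \<times> {..<nW K}
     \<and> (\<forall>w<nW K. \<exists>v. (w, v) \<in> rel K)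
     \<and> (\<forall>w<nW K. finite (lab K w)) \<and> rt K < nW K"

definition is_path :: "kripke \<Rightarrow> (nat \<Rightarrow> nat) \<Rightarrow> bool" where
  "is_path K \<pi> \<longleftrightarrow> \<pi> 0 = rt K \<and> (\<forall>i. (\<pi> i, \<pi> (Suc i)) \<in> rel K)"

definition team_of :: "kripke \<Rightarrow> trace set" where
  "team_of K = {(\<lambda>i. lab K (\<pi> i)) | \<pi>. is_path K \<pi>}"

datatype soterm = TVar nat | TZero | TOne | TPlus soterm soterm | TTimes soterm soterm

text \<open>Second-order variables are pairs (index, arity); \<open>Mem X ts\<close> refers to the
  second-order variable with index X and arity \<open>length ts\<close>.\<close>

datatype soform =
    Eq soterm soterm
  | Le soterm soterm
  | Mem nat "soterm list"
  | SNot soform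
  | SAnd soform soform
  | Ex1 nat soform
  | Ex2 nat nat soform

primrec teval :: "(nat \<Rightarrow> nat) \<Rightarrow> soterm \<Rightarrow> nat" where
  "teval v (TVar x) = v x"
| "teval v TZero = 0"
| "teval v TOne = 1"
| "teval v (TPlus s t) = teval v s + teval v t"
| "teval v (TTimes s t) = teval v s * teval v t"

primrec tvars :: "soterm \<Rightarrow> nat set" where
  "tvars (TVar x) = {x}"
| "tvars TZero = {}"
| "tvars TOne = {}"
| "tvars (TPlus s t) = tvars s \<union> tvars t"
| "tvars (TTimes s t) = tvars s \<union> tvars t"

primrec sosat :: "(nat \<Rightarrow> nat) \<Rightarrow> (nat \<Rightarrow> nat \<Rightarrow> nat list set) \<Rightarrow> soform \<Rightarrow> bool" where
  "sosat v V (Eq s t) = (teval v s = teval v t)"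
| "sosat v V (Le s t) = (teval v s \<le> teval v t)"
| "sosat v V (Mem X ts) = (map (teval v) ts \<in> V X (length ts))"
| "sosat v V (SNot \<phi>) = (\<not> sosat v V \<phi>)"
| "sosat v V (SAnd \<phi> \<psi>) = (sosat v V \<phi> \<and> sosat v V \<psi>)"
| "sosat v V (Ex1 x \<phi>) = (\<exists>n. sosat (v(x := n)) V \<phi>)"
| "sosat v V (Ex2 X k \<phi>) =
     (\<exists>S. S \<subseteq> {xs. length xs = k} \<and> sosat v (V(X := (V X)(k := S))) \<phi>)"

primrec fv1 :: "soform \<Rightarrow> nat set" where
  "fv1 (Eq s t) = tvars s \<union> tvars t"
| "fv1 (Le s t) = tvars s \<union> tvars t"
| "fv1 (Mem X ts) = \<Union> (set (map tvars ts))"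
| "fv1 (SNot \<phi>) = fv1 \<phi>"
| "fv1 (SAnd \<phi> \<psi>) = fv1 \<phi> \<union> fv1 \<psi>"
| "fv1 (Ex1 x \<phi>) = fv1 \<phi> - {x}"
| "fv1 (Ex2 X k \<phi>) = fv1 \<phi>"

primrec fv2 :: "soform \<Rightarrow> (nat \<times> nat) set" where
  "fv2 (Eq s t) = {}"
| "fv2 (Le s t) = {}"
| "fv2 (Mem X ts) = {(X, length ts)}"
| "fv2 (SNot \<phi>) = fv2 \<phi>"
| "fv2 (SAnd \<phi> \<psi>) = fv2 \<phi> \<union> fv2 \<psi>"
| "fv2 (Ex1 x \<phi>) = fv2 \<phi>"
| "fv2 (Ex2 X k \<phi>) = fv2 \<phi> - {(X, k)}"

definition closed_so :: "soform \<Rightarrow> bool" where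
  "closed_so \<phi> \<longleftrightarrow> fv1 \<phi> = {} \<and> fv2 \<phi> = {}"

text \<open>Truth in the standard model (for closed formulas the assignment is irrelevant).\<close>
definition true_so :: "soform \<Rightarrow> bool" where
  "true_so \<phi> \<longleftrightarrow> sosat (\<lambda>_. 0) (\<lambda>_ _. {}) \<phi>"

fun bin :: "nat \<Rightarrow> nat list" where
  "bin n = (if n < 2 then [n] else bin (n div 2) @ [n mod 2])"

definition enc_nat :: "nat \<Rightarrow> nat list" where
  "enc_nat n = bin n @ [2]"

primrec enc_ltl :: "ltl \<Rightarrow> nat list" where
  "enc_ltl (Prop p) = 3 # enc_nat p"
| "enc_ltl (Neg \<phi>) = 4 # enc_ltl \<phi>"
| "enc_ltl (Conj \<phi> \<psi>) = 5 # enc_ltl \<phi> @ enc_ltl \<psi>"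
| "enc_ltl (Disj \<phi> \<psi>) = 6 # enc_ltl \<phi> @ enc_ltl \<psi>"
| "enc_ltl (Next \<phi>) = 7 # enc_ltl \<phi>"
| "enc_ltl (Fin \<phi>) = 8 # enc_ltl \<phi>"
| "enc_ltl (Glob \<phi>) = 9 # enc_ltl \<phi>"
| "enc_ltl (Until \<phi> \<psi>) = 10 # enc_ltl \<phi> @ enc_ltl \<psi>"
| "enc_ltl (Release \<phi> \<psi>) = 11 # enc_ltl \<phi> @ enc_ltl \<psi>"
| "enc_ltl (Tilde \<phi>) = 12 # enc_ltl \<phi>"

definition enc_kripke :: "kripke \<Rightarrow> nat list" where
  "enc_kripke K = [13] @ enc_nat (nW K) @ enc_nat (rt K)
     @ concat (map (\<lambda>i. map (\<lambda>j. if (i, j) \<in> rel K then 1 else 0) [0..<nW K]) [0..<nW K])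
     @ concat (map (\<lambda>i. concat (map enc_nat (sorted_list_of_set (lab K i))) @ [14]) [0..<nW K])"

definition enc_instance :: "kripke \<Rightarrow> ltl \<Rightarrow> nat list" where
  "enc_instance K \<phi> = enc_kripke K @ enc_ltl \<phi>"

primrec enc_term :: "soterm \<Rightarrow> nat list" where
  "enc_term (TVar x) = 3 # enc_nat x"
| "enc_term TZero = [4]"
| "enc_term TOne = [5]"
| "enc_term (TPlus s t) = 6 # enc_term s @ enc_term t"
| "enc_term (TTimes s t) = 7 # enc_term s @ enc_term t"

primrec enc_so :: "soform \<Rightarrow> nat list" where
  "enc_so (Eq s t) = 8 # enc_term s @ enc_term t"
| "enc_so (Le s t) = 9 # enc_term s @ enc_term t"
| "enc_so (Mem X ts) = 10 # enc_nat X @ enc_nat (length ts) @ concat (map enc_term ts)"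
| "enc_so (SNot \<phi>) = 11 # enc_so \<phi>"
| "enc_so (SAnd \<phi> \<psi>) = 12 # enc_so \<phi> @ enc_so \<psi>"
| "enc_so (Ex1 x \<phi>) = 13 # enc_nat x @ enc_so \<phi>"
| "enc_so (Ex2 X k \<phi>) = 14 # enc_nat X @ enc_nat k @ enc_so \<phi>"

definition UP_MC :: "nat list set" where
  "UP_MC = {enc_instance K \<phi> | K \<phi>. wf_kripke K \<and> tsat (team_of K \<inter> {t. ult_periodic t}) \<phi>}"

definition UC_MC :: "nat list set" where
  "UC_MC = {enc_instance K \<phi> | K \<phi>. wf_kripke K \<and> tsat (team_of K \<inter> {t. ult_constant t}) \<phi>}"

definition Delta20 :: "nat list set" where
  "Delta20 = {enc_so \<phi> | \<phi>. closed_so \<phi> \<and> true_so \<phi>}"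

text \<open>A deterministic transducer with a two-way read-only input tape (with left endmarker 16
  and right endmarker 17), one work tape (blank symbol 0) and a write-only output tape.
  States are \<open>{0..<nq}\<close>, 0 is the start state and 1 the halting state; work symbols are
  \<open>{0..<nw}\<close>.  The transition function maps (state, input symbol, work symbol) to
  (new state, input head move, written work symbol, work head move, optional output symbol).\<close>

record tm =
  nq :: nat
  nw :: nat
  delta :: "nat \<Rightarrow> nat \<Rightarrow> nat \<Rightarrow> nat \<times> int \<times> nat \<times> int \<times> nat option"

definition wf_tm :: "tm \<Rightarrow> bool" where
  "wf_tm M \<longleftrightarrow> nq M \<ge> 2 \<and> nw M \<ge> 1 \<and>
     (\<forall>q<nq M. \<forall>a\<le>17. \<forall>b<nw M.
        (case delta M q a b of (q', di, b', dw, out) \<Rightarrow>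
           q' < nq M \<and> di \<in> {-1, 0, 1} \<and> b' < nw M \<and> dw \<in> {-1, 0, 1}
           \<and> (\<forall>s. out = Some s \<longrightarrow> s < 16)))"

type_synonym config = "nat \<times> nat \<times> (nat \<Rightarrow> nat) \<times> nat \<times> nat list"
  (* state, input head, work tape contents, work head, output written so far *)

definition in_sym :: "nat list \<Rightarrow> nat \<Rightarrow> nat" where
  "in_sym w i = (if i = 0 then 16 else if i \<le> length w then w ! (i - 1) else 17)"

definition move :: "nat \<Rightarrow> int \<Rightarrow> nat \<Rightarrow> nat" where
  "move i d bound = nat (min (int bound) (max 0 (int i + d)))"

definition tm_step :: "tm \<Rightarrow> nat list \<Rightarrow> config \<Rightarrow> config" where
  "tm_step M w c = (case c of (q, ih, wt, wh, out) \<Rightarrow>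
     if q = 1 then c else
     (case delta M q (in_sym w ih) (wt wh) of (q', di, b', dw, ot) \<Rightarrow>
        (q', move ih di (length w + 1), wt(wh := b'), nat (max 0 (int wh + dw)),
         out @ (case ot of None \<Rightarrow> [] | Some s \<Rightarrow> [s]))))"

definition tm_conf :: "tm \<Rightarrow> nat list \<Rightarrow> nat \<Rightarrow> config" where
  "tm_conf M w t = (tm_step M w ^^ t) (0, 0, (\<lambda>_. 0), 0, [])"

definition logspace_computes :: "tm \<Rightarrow> real \<Rightarrow> (nat list \<Rightarrow> nat list) \<Rightarrow> bool" where
  "logspace_computes M c f \<longleftrightarrow> wf_tm M \<and>
     (\<forall>w. set w \<subseteq> {..<16} \<longrightarrow>
        (\<exists>t. fst (tm_conf M w t) = 1 \<and> snd (snd (snd (snd (tm_conf M w t)))) = f w) \<and>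
        (\<forall>t. real (fst (snd (snd (snd (tm_conf M w t))))) \<le> c * log 2 (real (length w) + 2)))"

definition logspace_reducible :: "nat list set \<Rightarrow> nat list set \<Rightarrow> bool" where
  "logspace_reducible A B \<longleftrightarrow>
     (\<exists>M c f. logspace_computes M c f \<and>
        (\<forall>w. set w \<subseteq> {..<16} \<longrightarrow> (w \<in> A \<longleftrightarrow> f w \<in> B)))"

end

theory Submission
  imports Defs "HOL-Library.Countable_Set"
begin

text \<open>A fixed finite stock of variables suffices: inside the scope of its quantifiers a translated
  subformula may reuse all of them. Hence the translation of a string can be arranged, in prefix notation,
  so that every input symbol contributes a fixed block of output symbols, and the
  reduction is computed by a finite-state transducer, which needs no work tape at all.

  The only traces that matter are those of the countable team \<open>team_of K \<inter> C\<close>, so they are listed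
  by one ternary relation \<open>Z\<close>. Since all members of a team are always
  shifted together, a team is a set of rows of \<open>Z\<close> and one global time; the splitting connective
  becomes a quantifier over sets of rows and the temporal operators become quantifiers over time.

  The formula part of the input is an iterated context. The structure part is read by a register
  machine whose registers are first-order variables and whose steps are
  formulas with one hole; it compares the input with a transition matrix and a labelling that are
  guessed by outermost second-order quantifiers. Ill-formed input yields either a string
  that encodes no formula, because encodings are prefix-free, or a sentence in which this
  comparison fails.\<close>

section \<open>Finite-state transducers as Turing machines\<close>

text \<open>The transducer reads \<open>16 # w @ [17]\<close>; state 0 is initial and state 1 is final.\<close>

fun trun :: "(nat \<Rightarrow> nat \<Rightarrow> nat list) \<Rightarrow> (nat \<Rightarrow> nat \<Rightarrow> nat) \<Rightarrow> nat \<Rightarrow> nat list \<Rightarrow> nat list" where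
  "trun out nxt p [] = []"
| "trun out nxt p (a # w) = (if p = 1 then [] else out p a @ trun out nxt (nxt p a) w)"

text \<open>Machine state \<open>p + Q * k\<close> means: transducer state \<open>p\<close>, with \<open>k\<close> symbols of the
  current output block already written.\<close>

definition tm_of :: "(nat \<Rightarrow> nat \<Rightarrow> nat list) \<Rightarrow> (nat \<Rightarrow> nat \<Rightarrow> nat) \<Rightarrow> nat \<Rightarrow> tm" where
  "tm_of out nxt Q =
     \<lparr>nq = Q * ((\<Sum>p<Q. \<Sum>a\<le>17. length (out p a)) + 1), nw = 1,
      delta = (\<lambda>q a b. if q div Q < length (out (q mod Q) a)
        then (q + Q, 0, b, 0, Some (out (q mod Q) a ! (q div Q)))
        else (nxt (q mod Q) a, 1, b, 0, None))\<rparr>"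

context
  fixes out :: "nat \<Rightarrow> nat \<Rightarrow> nat list" and nxt :: "nat \<Rightarrow> nat \<Rightarrow> nat" and Q :: nat
  assumes Q: "Q \<ge> 2"
    and nxt: "\<And>p a. p < Q \<Longrightarrow> a \<le> 17 \<Longrightarrow> nxt p a < Q"
    and out: "\<And>p a. p < Q \<Longrightarrow> a \<le> 17 \<Longrightarrow> set (out p a) \<subseteq> {..<16}"
    and fin: "\<And>p. nxt p 17 = 1"
begin

text \<open>The sum of all block lengths bounds each of them, so \<open>Q * (?B + 1)\<close> states
  suffice for every pair of a transducer state and a position in its block.\<close>

lemma wf_tm_of: "wf_tm (tm_of out nxt Q)"
proof -
  let ?B = "\<Sum>p<Q. \<Sum>a\<le>17. length (out p a)"
  have B: "length (out p a) \<le> ?B" if "p < Q" "a \<le> 17" for p a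
  proof -
    have "length (out p a) \<le> (\<Sum>a\<le>17. length (out p a))"
      using that by (intro member_le_sum) auto
    also have "\<dots> \<le> ?B"
      using that by (intro member_le_sum[where f = "\<lambda>p. \<Sum>a\<le>17. length (out p a)"]) auto
    finally show ?thesis .
  qed
  have modQ: "q mod Q < Q" for q using Q by simp
  have 1: "q + Q < Q * (?B + 1)" if "q div Q < length (out (q mod Q) a)" "a \<le> 17" for q a
  proof -
    have "(q + Q) div Q < ?B + 1" using B[OF modQ that(2), of q] that(1) Q by simp
    then show ?thesis using Q by (metis div_less_iff_less_mult mult.commute not_numeral_le_zero gr0I)
  qed
  have 2: "nxt (q mod Q) a < Q * (?B + 1)" if "a \<le> 17" for q a
    using nxt[OF modQ that, of q] by (simp add: trans_less_add1)
  have 3: "out (q mod Q) a ! (q div Q) < 16"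
    if "q div Q < length (out (q mod Q) a)" "a \<le> 17" for q a
    using out[OF modQ that(2), of q] that(1) by (meson lessThan_iff nth_mem subsetD)
  have 4: "2 \<le> Q * (?B + 1)" using Q by simp
  show ?thesis
    unfolding wf_tm_def tm_of_def using 1 2 3 4 by (auto split: if_splits simp del: mult_Suc_right)
qed

text \<open>Induction on the number of symbols of the block still to be written. The input head
  stays put meanwhile and moves right only in the step that changes the transducer state.\<close>

lemma tm_of_emit:
  assumes "p < Q" "p \<noteq> 1" "k \<le> length (out p (in_sym w ih))"
    "ih \<le> length w + 1"
  shows "\<exists>t. (tm_step (tm_of out nxt Q) w ^^ t) (p + Q * k, ih, wt, wh, os) =
    (nxt p (in_sym w ih), move ih 1 (length w + 1), wt, wh, os @ drop k (out p (in_sym w ih)))"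
proof -
  \<comment> \<open>Modulo \<open>Q\<close> this state is \<open>p\<close>, so the machine cannot
    halt in the middle of a block.\<close>
  have start: "p + Q * k \<noteq> 1" for k
    using assms(1,2) Q mod_mult_self2[of p Q k] by (metis mod_less one_less_numeral_iff
      less_le_trans semiring_norm(76))
  show ?thesis using assms(3)
  proof (induction "length (out p (in_sym w ih)) - k" arbitrary: k os)
    case 0
    have "(p + Q * k) mod Q = p" "(p + Q * k) div Q = k" "p + Q * k \<noteq> 1"
      using start assms(1) by auto
    then have "(tm_step (tm_of out nxt Q) w ^^ 1) (p + Q * k, ih, wt, wh, os) =
        (nxt p (in_sym w ih), move ih 1 (length w + 1), wt, wh, os @ drop k (out p (in_sym w ih)))"
      using 0 by (auto simp: tm_step_def tm_of_def)
    then show ?case by blast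
  next
    case (Suc n)
    let ?o = "out p (in_sym w ih)"
    have "(p + Q * k) mod Q = p" "(p + Q * k) div Q = k" "p + Q * k \<noteq> 1" and k: "k < length ?o"
      using start assms(1) Suc.hyps(2) by auto
    then have step: "tm_step (tm_of out nxt Q) w (p + Q * k, ih, wt, wh, os) =
        (p + Q * Suc k, move ih 0 (length w + 1), wt, wh, os @ [?o ! k])"
      by (auto simp: tm_step_def tm_of_def)
    have mv: "move ih 0 (length w + 1) = ih" using assms(4) by (simp add: move_def)
    have n: "n = length ?o - Suc k" using Suc.hyps(2) by linarith
    obtain t where "(tm_step (tm_of out nxt Q) w ^^ t) (p + Q * Suc k, ih, wt, wh, os @ [?o ! k]) =
        (nxt p (in_sym w ih), move ih 1 (length w + 1), wt, wh, (os @ [?o ! k]) @ drop (Suc k) ?o)"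
      using Suc.hyps(1)[OF n, of "os @ [?o ! k]"] k by (auto simp del: mult_Suc_right)
    then have "(tm_step (tm_of out nxt Q) w ^^ Suc t) (p + Q * k, ih, wt, wh, os) =
        (nxt p (in_sym w ih), move ih 1 (length w + 1), wt, wh, os @ drop k ?o)"
      using step mv k by (simp add: funpow_Suc_right Cons_nth_drop_Suc del: mult_Suc_right funpow.simps)
    then show ?case by blast
  qed
qed

text \<open>Induction on the distance from the head to the right endmarker, where \<open>nxt\<close>
  always leads to the halting state.\<close>

lemma tm_of_run:
  assumes "p < Q" "ih \<le> length w + 1" "set w \<subseteq> {..<16}"
  shows "\<exists>t ih' wt' wh'. (tm_step (tm_of out nxt Q) w ^^ t) (p, ih, wt, wh, os) =
    (1, ih', wt', wh', os @ trun out nxt p (drop ih (16 # w @ [17])))"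
  using assms(1,2)
proof (induction "length w + 1 - ih" arbitrary: ih p os)
  case (0 ih p os)
  then have ih: "ih = length w + 1" by simp
  show ?case
  proof (cases "p = 1")
    case True
    then have "(tm_step (tm_of out nxt Q) w ^^ 0) (p, ih, wt, wh, os) =
        (1, ih, wt, wh, os @ trun out nxt p (drop ih (16 # w @ [17])))"
      using ih by simp
    then show ?thesis by blast
  next
    case False
    have sym: "in_sym w ih = 17" using ih by (simp add: in_sym_def)
    show ?thesis
      using tm_of_emit[OF 0(2) False, of 0 w ih wt wh os] ih False sym fin by auto
  qed
next
  case (Suc n ih p os)
  then have ih: "ih \<le> length w" by simp
  show ?case
  proof (cases "p = 1")
    case True
    then have "(tm_step (tm_of out nxt Q) w ^^ 0) (p, ih, wt, wh, os) =
        (1, ih, wt, wh, os @ trun out nxt p (drop ih (16 # w @ [17])))"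
      using ih by (cases "drop ih (16 # w @ [17])") auto
    then show ?thesis by blast
  next
    case False
    let ?a = "in_sym w ih"
    have a: "?a = (16 # w @ [17]) ! ih" using ih by (auto simp: in_sym_def nth_append nth_Cons')
    have a17: "?a \<le> 17"
    proof (cases "ih = 0")
      case False
      then have "?a \<in> set w" using ih by (simp add: in_sym_def)
      then show ?thesis using assms(3) by auto
    qed (simp add: in_sym_def)
    have d: "drop ih (16 # w @ [17]) = ?a # drop (Suc ih) (16 # w @ [17])"
      unfolding a using ih by (intro Cons_nth_drop_Suc[symmetric]) simp
    have mv: "move ih 1 (length w + 1) = Suc ih" using ih by (simp add: move_def)
    obtain t where t: "(tm_step (tm_of out nxt Q) w ^^ t) (p, ih, wt, wh, os) =
        (nxt p ?a, Suc ih, wt, wh, os @ out p ?a)"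
      using tm_of_emit[OF Suc.prems(1) False, of 0 w ih wt wh os] ih mv by auto
    have n: "n = length w + 1 - Suc ih" using Suc.hyps(2) by linarith
    obtain t' ih' wt' wh' where
      "(tm_step (tm_of out nxt Q) w ^^ t') (nxt p ?a, Suc ih, wt, wh, os @ out p ?a) =
        (1, ih', wt', wh', (os @ out p ?a) @ trun out nxt (nxt p ?a) (drop (Suc ih) (16 # w @ [17])))"
      using Suc.hyps(1)[OF n nxt[OF Suc.prems(1) a17], of "os @ out p ?a"] ih by fastforce
    then have "(tm_step (tm_of out nxt Q) w ^^ (t' + t)) (p, ih, wt, wh, os) =
        (1, ih', wt', wh', os @ trun out nxt p (drop ih (16 # w @ [17])))"
      using t d False by (simp add: funpow_add)
    then show ?thesis by blast
  qed
qed

text \<open>No transition moves the work head, so the space bound is trivially logarithmic.\<close>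

lemma tm_of_head: "fst (snd (snd (snd (tm_conf (tm_of out nxt Q) w t)))) = 0"
  by (induction t)
    (auto simp: tm_conf_def tm_step_def tm_of_def split: prod.splits if_splits)

lemma tm_of_computes:
  "logspace_computes (tm_of out nxt Q) 1 (\<lambda>w. trun out nxt 0 (16 # w @ [17]))"
  unfolding logspace_computes_def
proof (intro conjI allI impI)
  fix w :: "nat list" assume w: "set w \<subseteq> {..<16}"
  show "\<exists>t. fst (tm_conf (tm_of out nxt Q) w t) = 1 \<and>
      snd (snd (snd (snd (tm_conf (tm_of out nxt Q) w t)))) = trun out nxt 0 (16 # w @ [17])"
    using tm_of_run[of 0 0 w "\<lambda>_. 0" 0 "[]"] w Q unfolding tm_conf_def
    by (metis append_Nil drop0 fst_conv snd_conv gr0I not_numeral_le_zero le0)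
qed (simp_all add: wf_tm_of tm_of_head)

end

section \<open>Unique readability\<close>

declare bin.simps [simp del]

lemma bin_less_2: "n < 2 \<Longrightarrow> bin n = [n]"
  by (simp add: bin.simps)

lemma bin_step: "x \<noteq> 0 \<Longrightarrow> b < 2 \<Longrightarrow> bin (2 * x + b) = bin x @ [b]"
  by (subst bin.simps) auto

lemma set_bin: "set (bin n) \<subseteq> {0, 1}"
proof (induction n rule: bin.induct)
  case (1 n)
  then show ?case by (subst bin.simps) (cases "even n"; auto simp: less_2_cases_iff odd_iff_mod_2_eq_one)
qed

lemma foldl_bin: "foldl (\<lambda>x b. 2 * x + b) 0 (bin n) = n"
proof (induction n rule: bin.induct)
  case (1 n)
  then show ?case by (subst bin.simps) auto
qed

text \<open>The terminator 2 is not a binary digit, so the digits can be cut off at it, and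
  evaluating them by Horner's rule returns the number.\<close>

lemma enc_nat_prefix: "enc_nat n @ s = enc_nat m @ s' \<longleftrightarrow> n = m \<and> s = s'"
proof
  assume eq: "enc_nat n @ s = enc_nat m @ s'"
  have "x \<in> set (bin k) \<Longrightarrow> x \<noteq> 2" for x k using set_bin[of k] by auto
  then have "takeWhile (\<lambda>x. x \<noteq> 2) (enc_nat k @ s) = bin k" for k s
    unfolding enc_nat_def by (simp add: takeWhile_append2)
  then have "bin n = bin m" using eq by metis
  then show "n = m \<and> s = s'" using foldl_bin eq by (metis same_append_eq)
qed simp

lemma set_enc_nat: "set (enc_nat n) \<subseteq> {..2}"
  using set_bin[of n] by (auto simp: enc_nat_def)

lemma enc_term_prefix: "enc_term t @ s = enc_term t' @ s' \<longleftrightarrow> t = t' \<and> s = s'"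
proof (induction t arbitrary: t' s s')
  case (TVar x) then show ?case by (cases t') (auto simp: enc_nat_prefix)
next
  case TZero then show ?case by (cases t') auto
next
  case TOne then show ?case by (cases t') auto
next
  case (TPlus a b) then show ?case by (cases t') auto
next
  case (TTimes a b) then show ?case by (cases t') auto
qed

lemma enc_terms_prefix:
  "length ts = length ts' \<Longrightarrow> concat (map enc_term ts) @ s = concat (map enc_term ts') @ s'
    \<longleftrightarrow> ts = ts' \<and> s = s'"
  by (induction ts ts' rule: list_induct2) (auto simp: enc_term_prefix)

text \<open>Polish notation is uniquely readable: the leading symbol fixes the constructor, and the
  arguments are split off from left to right. For \<open>Mem\<close> the arity precedes the
  arguments and tells how many to read.\<close>

lemma enc_so_prefix: "enc_so \<phi> @ s = enc_so \<psi> @ s' \<longleftrightarrow> \<phi> = \<psi> \<and> s = s'"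
proof (induction \<phi> arbitrary: \<psi> s s')
  case (Eq t u) then show ?case by (cases \<psi>) (auto simp: enc_term_prefix)
next
  case (Le t u) then show ?case by (cases \<psi>) (auto simp: enc_term_prefix)
next
  case (Mem X ts) then show ?case
    by (cases \<psi>) (auto simp: enc_nat_prefix enc_terms_prefix)
next
  case (SNot a) then show ?case by (cases \<psi>) auto
next
  case (SAnd a b) then show ?case by (cases \<psi>) auto
next
  case (Ex1 x a) then show ?case by (cases \<psi>) (auto simp: enc_nat_prefix)
next
  case (Ex2 X k a) then show ?case by (cases \<psi>) (auto simp: enc_nat_prefix)
qed

lemma set_enc_term: "set (enc_term t) \<subseteq> {..14}"
proof (induction t)
  case (TVar x) then show ?case using set_enc_nat[of x] by auto
qed auto

text \<open>This leaves 15 free as an error mark.\<close>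

lemma set_enc_so: "set (enc_so \<phi>) \<subseteq> {..14}"
proof (induction \<phi>)
  case (Eq t u) then show ?case using set_enc_term by fastforce
next
  case (Le t u) then show ?case using set_enc_term by fastforce
next
  case (Mem X ts)
  have "set (concat (map enc_term ts)) \<subseteq> {..14}" using set_enc_term by fastforce
  moreover have "set (enc_nat X) \<subseteq> {..14}" "set (enc_nat (length ts)) \<subseteq> {..14}"
    using set_enc_nat by fastforce+
  ultimately show ?case by auto
next
  case (Ex1 x a) then show ?case using set_enc_nat[of x] by auto
next
  case (Ex2 X k a) then show ?case using set_enc_nat[of X] set_enc_nat[of k] by auto
qed auto

section \<open>Contexts with a rightmost hole\<close>

datatype item = INot | IAnd soform | IEx1 nat | IEx2 nat nat

primrec app1 :: "item \<Rightarrow> soform \<Rightarrow> soform" where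
  "app1 INot h = SNot h"
| "app1 (IAnd \<phi>) h = SAnd \<phi> h"
| "app1 (IEx1 x) h = Ex1 x h"
| "app1 (IEx2 X k) h = Ex2 X k h"

primrec app :: "item list \<Rightarrow> soform \<Rightarrow> soform" where
  "app [] h = h"
| "app (i # c) h = app1 i (app c h)"

primrec str1 :: "item \<Rightarrow> nat list" where
  "str1 INot = [11]"
| "str1 (IAnd \<phi>) = 12 # enc_so \<phi>"
| "str1 (IEx1 x) = 13 # enc_nat x"
| "str1 (IEx2 X k) = 14 # enc_nat X @ enc_nat k"

definition str :: "item list \<Rightarrow> nat list" where
  "str c = concat (map str1 c)"

lemma str_simps [simp]: "str [] = []" "str (i # c) = str1 i @ str c" "str (c @ d) = str c @ str d"
  by (auto simp: str_def)

lemma app_append [simp]: "app (c @ d) h = app c (app d h)"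
  by (induction c) auto

text \<open>As the hole is at the right end in prefix notation, plugging is concatenation. This is
  what allows a formula to be written while the input is being read.\<close>

lemma enc_app: "enc_so (app c h) = str c @ enc_so h"
proof (induction c)
  case (Cons i c)
  then show ?case by (cases i) auto
qed simp

lemma set_str: "set (str c) \<subseteq> {..14}"
proof -
  have "set (str c) \<subseteq> set (enc_so (app c (Eq TZero TZero)))"
    by (auto simp: enc_app)
  then show ?thesis using set_enc_so by blast
qed

section \<open>Derived connectives, variables and assignment blocks\<close>

definition SOr :: "soform \<Rightarrow> soform \<Rightarrow> soform" where
  "SOr \<phi> \<psi> = SNot (SAnd (SNot \<phi>) (SNot \<psi>))"
definition SImp :: "soform \<Rightarrow> soform \<Rightarrow> soform" where
  "SImp \<phi> \<psi> = SNot (SAnd \<phi> (SNot \<psi>))"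
definition SIff :: "soform \<Rightarrow> soform \<Rightarrow> soform" where
  "SIff \<phi> \<psi> = SAnd (SImp \<phi> \<psi>) (SImp \<psi> \<phi>)"
definition All1 :: "nat \<Rightarrow> soform \<Rightarrow> soform" where
  "All1 x \<phi> = SNot (Ex1 x (SNot \<phi>))"
definition All2 :: "nat \<Rightarrow> nat \<Rightarrow> soform \<Rightarrow> soform" where
  "All2 X k \<phi> = SNot (Ex2 X k (SNot \<phi>))"
definition Lt :: "soterm \<Rightarrow> soterm \<Rightarrow> soform" where
  "Lt s t = SNot (Le t s)"

lemma sosat_derived [simp]:
  "sosat v V (SOr \<phi> \<psi>) \<longleftrightarrow> sosat v V \<phi> \<or> sosat v V \<psi>"
  "sosat v V (SImp \<phi> \<psi>) \<longleftrightarrow> (sosat v V \<phi> \<longrightarrow> sosat v V \<psi>)"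
  "sosat v V (SIff \<phi> \<psi>) \<longleftrightarrow> (sosat v V \<phi> \<longleftrightarrow> sosat v V \<psi>)"
  "sosat v V (All1 x \<phi>) \<longleftrightarrow> (\<forall>n. sosat (v(x := n)) V \<phi>)"
  "sosat v V (All2 X k \<phi>) \<longleftrightarrow>
    (\<forall>S. S \<subseteq> {xs. length xs = k} \<longrightarrow> sosat v (V(X := (V X)(k := S))) \<phi>)"
  "sosat v V (Lt s t) \<longleftrightarrow> teval v s < teval v t"
  by (auto simp: SOr_def SImp_def SIff_def All1_def All2_def Lt_def)

lemma fv_derived [simp]:
  "fv1 (SOr \<phi> \<psi>) = fv1 \<phi> \<union> fv1 \<psi>" "fv2 (SOr \<phi> \<psi>) = fv2 \<phi> \<union> fv2 \<psi>"
  "fv1 (SImp \<phi> \<psi>) = fv1 \<phi> \<union> fv1 \<psi>" "fv2 (SImp \<phi> \<psi>) = fv2 \<phi> \<union> fv2 \<psi>"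
  "fv1 (SIff \<phi> \<psi>) = fv1 \<phi> \<union> fv1 \<psi>" "fv2 (SIff \<phi> \<psi>) = fv2 \<phi> \<union> fv2 \<psi>"
  "fv1 (All1 x \<phi>) = fv1 \<phi> - {x}" "fv2 (All1 x \<phi>) = fv2 \<phi>"
  "fv1 (All2 X k \<phi>) = fv1 \<phi>" "fv2 (All2 X k \<phi>) = fv2 \<phi> - {(X, k)}"
  "fv1 (Lt s t) = tvars s \<union> tvars t" "fv2 (Lt s t) = {}"
  by (auto simp: SOr_def SImp_def SIff_def All1_def All2_def Lt_def)

text \<open>First-order variables: \<open>vn\<close>, \<open>vr\<close> hold the number of worlds and the root, \<open>vs\<close> the time
  reached by the team; \<open>vm\<close>, \<open>vx\<close>, \<open>vd\<close>, \<open>vl\<close>, \<open>vi\<close>, \<open>vp\<close> are registers of the reader.\<close>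

abbreviation (input) "vn \<equiv> 0 :: nat"
abbreviation (input) "vr \<equiv> 2 :: nat"
abbreviation (input) "vm \<equiv> 3 :: nat"
abbreviation (input) "vx \<equiv> 4 :: nat"
abbreviation (input) "vd \<equiv> 5 :: nat"
abbreviation (input) "vl \<equiv> 6 :: nat"
abbreviation (input) "vi \<equiv> 7 :: nat"
abbreviation (input) "vs \<equiv> 8 :: nat"
abbreviation (input) "vt \<equiv> 9 :: nat"
abbreviation (input) "vc \<equiv> 10 :: nat"
abbreviation (input) "ve \<equiv> 11 :: nat"
abbreviation (input) "vp \<equiv> 12 :: nat"
abbreviation (input) "va \<equiv> 13 :: nat"
abbreviation (input) "vb \<equiv> 14 :: nat"
abbreviation (input) "vk \<equiv> 15 :: nat"
abbreviation (input) "vu \<equiv> 16 :: nat"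
abbreviation (input) "vj \<equiv> 17 :: nat"

text \<open>Second-order variables: a team is given by a set \<open>VA\<close> of row numbers of the fixed table
  \<open>VZ\<close> of traces; \<open>VE\<close> and \<open>VL\<close> are the transition matrix and the labelling.\<close>

abbreviation (input) "VA \<equiv> 0 :: nat"
abbreviation (input) "VE \<equiv> 2 :: nat"
abbreviation (input) "VL \<equiv> 3 :: nat"
abbreviation (input) "VX \<equiv> 4 :: nat"
abbreviation (input) "VP \<equiv> 5 :: nat"
abbreviation (input) "VS \<equiv> 6 :: nat"
abbreviation (input) "VU \<equiv> 7 :: nat"
abbreviation (input) "VZ \<equiv> 8 :: nat"

abbreviation (input) "ar1 \<equiv> Suc 0"
abbreviation (input) "ar2 \<equiv> Suc (Suc 0)"
abbreviation (input) "ar3 \<equiv> Suc (Suc (Suc 0))"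

abbreviation (input) "M1 X s \<equiv> Mem X [s]"
abbreviation (input) "M2 X s t \<equiv> Mem X [s, t]"
abbreviation (input) "M3 X s t u \<equiv> Mem X [s, t, u]"

text \<open>Quantifiers with exactly one witness serve as assignments. The value passes through
  \<open>vt\<close> because \<open>t\<close> may mention the old value of \<open>x\<close>, which
  \<open>Ex1 x\<close> would capture.\<close>

definition asg :: "nat \<Rightarrow> soterm \<Rightarrow> item list" where
  "asg x t = [IEx1 vt, IAnd (Eq (TVar vt) t), IEx1 x, IAnd (Eq (TVar x) (TVar vt))]"

lemma sosat_asg [simp]:
  assumes "vt \<notin> tvars t" "x \<noteq> vt"
  shows "sosat v V (app (asg x t) h) \<longleftrightarrow> sosat (v(vt := teval v t, x := teval v t)) V h"
proof -
  have "vt \<notin> tvars t \<Longrightarrow> teval (v(vt := n)) t = teval v t" for n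
    by (induction t) auto
  then show ?thesis using assms by (simp add: asg_def)
qed

lemma fv_asg:
  assumes "x \<noteq> vt"
  shows "fv1 (app (asg x t) h) = (tvars t - {vt}) \<union> (fv1 h - {x, vt})"
    "fv2 (app (asg x t) h) = fv2 h"
  using assms by (auto simp: asg_def)

section \<open>Translation of formulas\<close>

definition row :: "nat list set \<Rightarrow> nat \<Rightarrow> trace" where
  "row Z c = (\<lambda>j. {p. [c, j, p] \<in> Z})"

definition same_set :: "nat \<Rightarrow> nat \<Rightarrow> soform" where
  "same_set X Y = All1 va (SIff (M1 X (TVar va)) (M1 Y (TVar va)))"

text \<open>The argument is the input symbol of the connective. Symbol 4 denies that some singleton
  subteam satisfies the argument; symbol 9 expresses a universal quantifier by two negations around
  an existential one; the default is the plain negation for symbol 12.\<close>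

definition un :: "nat \<Rightarrow> item list" where
  "un a =
    (if a = 4 then [INot, IEx1 vb, IAnd (M1 VA (TVar vb)), IEx2 VA ar1,
        IAnd (All1 va (SIff (M1 VA (TVar va)) (Eq (TVar va) (TVar vb))))]
     else if a = 7 then asg vs (TPlus (TVar vs) TOne)
     else if a = 8 then [IEx1 vk] @ asg vs (TPlus (TVar vs) (TVar vk))
     else if a = 9 then [INot, IEx1 vk] @ asg vs (TPlus (TVar vs) (TVar vk)) @ [INot]
     else [INot])"

text \<open>A binary connective is \<open>app (bc a) (SAnd (app (bd a) \<phi>) \<psi>)\<close>, so that the two translated
  subformulas are adjacent in the encoding. To avoid a negated right argument, \<open>Release\<close> is
  expressed as: there are \<open>b\<close>, \<open>m\<close> such that \<open>b = 0\<close> or \<open>\<phi>\<close> holds at \<open>m\<close>,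
  and \<open>\<psi>\<close> holds at all \<open>k\<close> with \<open>b = 0\<close> or \<open>k \<le> m\<close>.\<close>

definition bc :: "nat \<Rightarrow> item list" where
  "bc a =
    (if a = 6 then [IEx2 VS ar1, IEx2 VU ar1,
        IAnd (All1 va (SIff (M1 VA (TVar va)) (SOr (M1 VS (TVar va)) (M1 VU (TVar va))))),
        IEx2 VA ar1, IAnd (same_set VA VU)]
     else if a = 10 then asg vu (TVar vs) @ [IEx1 vk] @ asg vs (TPlus (TVar vu) (TVar vk))
     else if a = 11 then asg vu (TVar vs) @ [IEx1 vb, IEx1 vj, INot, IEx1 vk,
        IAnd (SOr (Eq (TVar vb) TZero) (Le (TVar vk) (TVar vj)))] @
        asg vs (TPlus (TVar vu) (TVar vk)) @ [INot]
     else [])"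

text \<open>When the left argument is reached, \<open>bc\<close> has already set \<open>VA\<close>
  or \<open>vs\<close> for the right one. They are therefore set again, from \<open>VS\<close> or
  from the starting time saved in \<open>vu\<close>.\<close>

definition bd :: "nat \<Rightarrow> item list" where
  "bd a =
    (if a = 6 then [IEx2 VA ar1, IAnd (same_set VA VS)]
     else if a = 10 then [INot, IEx1 vj, IAnd (Lt (TVar vj) (TVar vk))] @
        asg vs (TPlus (TVar vu) (TVar vj)) @ [INot]
     else if a = 11 then [INot, IAnd (SNot (Eq (TVar vb) TZero))] @
        asg vs (TPlus (TVar vu) (TVar vj)) @ [INot]
     else [])"

definition bin_form :: "nat \<Rightarrow> soform \<Rightarrow> soform \<Rightarrow> soform" where
  "bin_form a \<phi> \<psi> = app (bc a) (SAnd (app (bd a) \<phi>) \<psi>)"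

text \<open>One step of Horner's rule, so that the index of a proposition is evaluated by one fixed
  block per binary digit.\<close>

definition pdig :: "nat \<Rightarrow> item list" where
  "pdig b = asg vx (TPlus (TPlus (TVar vx) (TVar vx)) (if b = 0 then TZero else TOne))"

definition pfin :: soform where
  "pfin = All1 va (SImp (M1 VA (TVar va)) (M3 VZ (TVar va) (TVar vs) (TVar vx)))"

primrec tr :: "ltl \<Rightarrow> soform" where
  "tr (Prop p) = app (asg vx TZero @ concat (map pdig (bin p))) pfin"
| "tr (Neg \<phi>) = app (un 4) (tr \<phi>)"
| "tr (Conj \<phi> \<psi>) = bin_form 5 (tr \<phi>) (tr \<psi>)"
| "tr (Disj \<phi> \<psi>) = bin_form 6 (tr \<phi>) (tr \<psi>)"
| "tr (Next \<phi>) = app (un 7) (tr \<phi>)"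
| "tr (Fin \<phi>) = app (un 8) (tr \<phi>)"
| "tr (Glob \<phi>) = app (un 9) (tr \<phi>)"
| "tr (Until \<phi> \<psi>) = bin_form 10 (tr \<phi>) (tr \<psi>)"
| "tr (Release \<phi> \<psi>) = bin_form 11 (tr \<phi>) (tr \<psi>)"
| "tr (Tilde \<phi>) = app (un 12) (tr \<phi>)"

text \<open>The existential assignment hides what is left in \<open>vt\<close>; it is chosen before
  \<open>h\<close>, so that one assignment serves every content of the hole.\<close>

lemma sosat_pdigs:
  assumes "set bs \<subseteq> {0, 1}"
  shows "\<exists>v'. v' vx = foldl (\<lambda>x b. 2 * x + b) (v vx) bs \<and> v' vs = v vs \<and>
    (\<forall>h. sosat v V (app (concat (map pdig bs)) h) = sosat v' V h)"
  using assms
proof (induction bs arbitrary: v)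
  case (Cons b bs)
  define w where "w = v(vt := 2 * v vx + b, vx := 2 * v vx + b)"
  have w: "w vx = 2 * v vx + b" "w vs = v vs" by (auto simp: w_def)
  have bs: "set bs \<subseteq> {0, 1}" using Cons.prems by simp
  have "sosat v V (app (pdig b) h) = sosat w V h" for h
    using Cons.prems by (auto simp: pdig_def mult_2 w_def)
  moreover obtain v' where "v' vx = foldl (\<lambda>x b. 2 * x + b) (w vx) bs" "v' vs = w vs"
    "\<forall>h. sosat w V (app (concat (map pdig bs)) h) = sosat v' V h"
    using Cons.IH[OF bs, of w] by blast
  ultimately show ?case using w by (intro exI[of _ v']) simp
qed auto

definition team :: "(nat \<Rightarrow> nat) \<Rightarrow> (nat \<Rightarrow> nat \<Rightarrow> nat list set) \<Rightarrow> trace set" where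
  "team v V = (\<lambda>c. suffix (row (V VZ ar3) c) (v vs)) ` {c. [c] \<in> V VA ar1}"

text \<open>Synchronous semantics shifts all traces alike, so a suffix of a team only advances the
  common clock.\<close>

lemma team_suffix_team: "team_suffix (team v V) k = team (v(vs := v vs + k)) V"
  by (auto simp: team_suffix_def team_def suffix_def image_image add.assoc)

text \<open>If \<open>Q\<close> holds somewhere, take \<open>b = 1\<close> and the least such
  \<open>m\<close>; no earlier position releases \<open>P\<close>, so it holds up to and including
  \<open>m\<close>. If \<open>Q\<close> never holds, take \<open>b = 0\<close>, which demands
  \<open>P\<close> everywhere.\<close>

lemma release_alt:
  "(\<forall>k::nat. P k \<or> (\<exists>j<k. Q j)) \<longleftrightarrow>
    (\<exists>b m. \<forall>k. b = (0::nat) \<or> k \<le> m \<longrightarrow> (b = 0 \<or> Q m) \<and> P k)" (is "?L \<longleftrightarrow> ?R")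
proof
  assume L: ?L
  show ?R
  proof (cases "\<exists>m. Q m")
    case True
    let ?m = "LEAST m. Q m"
    have "Q ?m" using True by (rule LeastI_ex)
    moreover have "P k" if "k \<le> ?m" for k
      using L that not_less_Least[of _ Q] by (meson less_le_trans)
    ultimately have "\<forall>k. (1::nat) = 0 \<or> k \<le> ?m \<longrightarrow> ((1::nat) = 0 \<or> Q ?m) \<and> P k" by auto
    then show ?R by blast
  next
    case False
    then have "\<forall>k. (0::nat) = 0 \<or> k \<le> 0 \<longrightarrow> ((0::nat) = 0 \<or> Q 0) \<and> P k" using L by blast
    then show ?R by blast
  qed
next
  assume ?R
  then obtain b m where "\<forall>k. b = (0::nat) \<or> k \<le> m \<longrightarrow> (b = 0 \<or> Q m) \<and> P k" by blast
  then show ?L by (metis le0 not_le)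
qed

text \<open>The induction ranges over all assignments because the connectives rebind the clock and
  the row set before passing to their arguments.\<close>

lemma sosat_tr: "sosat v V (tr \<phi>) \<longleftrightarrow> tsat (team v V) \<phi>"
proof (induction \<phi> arbitrary: v V)
  case (Prop p)
  obtain v' where v': "v' vx = p" "v' vs = v vs"
    "\<And>h. sosat (v(vt := 0, vx := 0)) V (app (concat (map pdig (bin p))) h) = sosat v' V h"
    using sosat_pdigs[OF set_bin[of p], of "v(vt := 0, vx := 0)" V] foldl_bin by auto
  then show ?case by (auto simp: pfin_def team_def suffix_def row_def)
next
  case (Neg \<phi>)
  let ?D = "\<lambda>S c. S \<subseteq> {xs. length xs = ar1} \<and> (\<forall>a. ([a] \<in> S) = (a = c))"
  have "(\<exists>S. ?D S c \<and> tsat (team (v(vb := c)) (V(VA := (V VA)(ar1 := S)))) \<phi>) \<longleftrightarrow>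
      tsat {suffix (row (V VZ ar3) c) (v vs)} \<phi>" for c
  proof -
    have "team (v(vb := c)) (V(VA := (V VA)(ar1 := S))) = {suffix (row (V VZ ar3) c) (v vs)}"
      if "?D S c" for S
      using that by (auto simp: team_def)
    moreover have "?D {[c]} c" by auto
    ultimately show ?thesis by metis
  qed
  moreover have IH: "\<And>v V. sosat v V (tr \<phi>) \<longleftrightarrow> tsat (team v V) \<phi>" by (rule Neg)
  ultimately have "sosat v V (tr (Neg \<phi>)) \<longleftrightarrow>
      \<not> (\<exists>c. [c] \<in> V VA ar1 \<and> tsat {suffix (row (V VZ ar3) c) (v vs)} \<phi>)"
    by (simp add: un_def)
  also have "\<dots> \<longleftrightarrow> tsat (team v V) (Neg \<phi>)"
    by (auto simp: team_def)
  finally show ?case .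
next
  case (Disj \<phi> \<psi>)
  have IH: "\<And>v V. sosat v V (tr \<phi>) \<longleftrightarrow> tsat (team v V) \<phi>"
    "\<And>v V. sosat v V (tr \<psi>) \<longleftrightarrow> tsat (team v V) \<psi>" by (rule Disj)+
  let ?L = "{xs :: nat list. length xs = ar1}"
  let ?f = "\<lambda>c. suffix (row (V VZ ar3) c) (v vs)"
  have ex: "(\<exists>S. S \<subseteq> ?L \<and> (\<forall>n. ([n] \<in> S) = ([n] \<in> B)) \<and> R) \<longleftrightarrow> R" for B and R :: bool
    by (auto intro!: exI[of _ "B \<inter> ?L"])
  have "sosat v V (tr (Disj \<phi> \<psi>)) \<longleftrightarrow>
      (\<exists>S U. S \<subseteq> ?L \<and> U \<subseteq> ?L \<and> (\<forall>n. [n] \<in> V VA ar1 \<longleftrightarrow> [n] \<in> S \<or> [n] \<in> U) \<and>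
        tsat (?f ` {c. [c] \<in> S}) \<phi> \<and> tsat (?f ` {c. [c] \<in> U}) \<psi>)"
    by (simp add: bin_form_def bc_def bd_def IH same_set_def team_def ex cong: conj_cong)
  also have "\<dots> \<longleftrightarrow> tsat (team v V) (Disj \<phi> \<psi>)"
  proof
    assume "\<exists>S U. S \<subseteq> ?L \<and> U \<subseteq> ?L \<and> (\<forall>n. [n] \<in> V VA ar1 \<longleftrightarrow> [n] \<in> S \<or> [n] \<in> U) \<and>
        tsat (?f ` {c. [c] \<in> S}) \<phi> \<and> tsat (?f ` {c. [c] \<in> U}) \<psi>"
    then obtain S U where "\<forall>n. [n] \<in> V VA ar1 \<longleftrightarrow> [n] \<in> S \<or> [n] \<in> U"
      and sat: "tsat (?f ` {c. [c] \<in> S}) \<phi>" "tsat (?f ` {c. [c] \<in> U}) \<psi>" by blast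
    then have "team v V = ?f ` {c. [c] \<in> S} \<union> ?f ` {c. [c] \<in> U}" by (auto simp: team_def)
    then show "tsat (team v V) (Disj \<phi> \<psi>)" using sat by auto
  next
    assume "tsat (team v V) (Disj \<phi> \<psi>)"
    then obtain A B where AB: "team v V = A \<union> B" "tsat A \<phi>" "tsat B \<psi>" by auto
    \<comment> \<open>Several rows may hold the same trace, so a split of the team is pulled back to
      row numbers along \<open>?f\<close>.\<close>
    let ?S = "{[c] | c. [c] \<in> V VA ar1 \<and> ?f c \<in> A}"
    let ?U = "{[c] | c. [c] \<in> V VA ar1 \<and> ?f c \<in> B}"
    have "\<forall>n. [n] \<in> V VA ar1 \<longleftrightarrow> [n] \<in> ?S \<or> [n] \<in> ?U"
      using AB(1) by (auto simp: team_def)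
    moreover have "A = ?f ` {c. [c] \<in> ?S}" "B = ?f ` {c. [c] \<in> ?U}"
      using AB(1) by (auto simp: team_def)
    then have "tsat (?f ` {c. [c] \<in> ?S}) \<phi> \<and> tsat (?f ` {c. [c] \<in> ?U}) \<psi>" using AB by simp
    moreover have "?S \<subseteq> ?L" "?U \<subseteq> ?L" by auto
    ultimately show "\<exists>S U. S \<subseteq> ?L \<and> U \<subseteq> ?L \<and> (\<forall>n. [n] \<in> V VA ar1 \<longleftrightarrow> [n] \<in> S \<or> [n] \<in> U) \<and>
        tsat (?f ` {c. [c] \<in> S}) \<phi> \<and> tsat (?f ` {c. [c] \<in> U}) \<psi>" by blast
  qed
  finally show ?case .
next
  case (Until \<phi> \<psi>)
  have IH: "\<And>v V. sosat v V (tr \<phi>) \<longleftrightarrow> tsat (team v V) \<phi>"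
    "\<And>v V. sosat v V (tr \<psi>) \<longleftrightarrow> tsat (team v V) \<psi>" by (rule Until)+
  show ?case
    by (simp add: bin_form_def bc_def bd_def IH team_suffix_team) (auto simp add: team_def)
next
  case (Release \<phi> \<psi>)
  have IH: "\<And>v V. sosat v V (tr \<phi>) \<longleftrightarrow> tsat (team v V) \<phi>"
    "\<And>v V. sosat v V (tr \<psi>) \<longleftrightarrow> tsat (team v V) \<psi>" by (rule Release)+
  show ?case unfolding tsat.simps release_alt[where P = "\<lambda>k. tsat (team_suffix (team v V) k) \<psi>"]
    by (simp add: bin_form_def bc_def bd_def IH team_suffix_team, simp add: team_def,
      (intro ex_cong1 all_cong1; auto))
next
  case (Conj \<phi> \<psi>)
  then show ?case by (simp add: bin_form_def bc_def bd_def)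
next
  case (Next \<phi>)
  show ?case by (simp add: un_def Next team_suffix_team) (simp add: team_def)
next
  case (Fin \<phi>)
  show ?case by (simp add: un_def Fin team_suffix_team) (simp add: team_def)
next
  case (Glob \<phi>)
  show ?case by (simp add: un_def Glob team_suffix_team) (simp add: team_def)
next
  case (Tilde \<phi>)
  then show ?case by (simp add: un_def)
qed

lemma fv_un:
  assumes "fv1 h \<subseteq> {vs}" "fv2 h \<subseteq> {(VA, ar1), (VZ, ar3)}"
  shows "fv1 (app (un a) h) \<subseteq> {vs}" "fv2 (app (un a) h) \<subseteq> {(VA, ar1), (VZ, ar3)}"
  using assms by (auto simp: un_def fv_asg)

lemma fv_bin_form:
  assumes "fv1 g \<subseteq> {vs}" "fv2 g \<subseteq> {(VA, ar1), (VZ, ar3)}"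
    "fv1 h \<subseteq> {vs}" "fv2 h \<subseteq> {(VA, ar1), (VZ, ar3)}"
  shows "fv1 (bin_form a g h) \<subseteq> {vs}" "fv2 (bin_form a g h) \<subseteq> {(VA, ar1), (VZ, ar3)}"
  using assms by (auto simp: bin_form_def bc_def bd_def fv_asg same_set_def)

lemma fv_pdigs:
  "fv1 h \<subseteq> {vs, vx} \<Longrightarrow> fv1 (app (concat (map pdig bs)) h) \<subseteq> {vs, vx}"
  "fv2 (app (concat (map pdig bs)) h) = fv2 h"
  by (induction bs) (auto simp: pdig_def fv_asg)

text \<open>Only the clock, the row set and the table stay free, which is why subformulas may reuse
  all auxiliary variables.\<close>

lemma fv_tr: "fv1 (tr \<phi>) \<subseteq> {vs} \<and> fv2 (tr \<phi>) \<subseteq> {(VA, ar1), (VZ, ar3)}"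
proof (induction \<phi>)
  case (Prop p)
  have "fv1 pfin \<subseteq> {vs, vx}" "fv2 pfin = {(VA, ar1), (VZ, ar3)}"
    by (auto simp: pfin_def)
  then show ?case using fv_pdigs(1)[of pfin "bin p"] fv_pdigs(2)[of "bin p" pfin] by (auto simp: fv_asg)
qed (simp_all add: fv_un fv_bin_form del: app.simps)

section \<open>The transducer\<close>

text \<open>Phases: 2 expects the leading 13; 3, 4, 5 read the number of worlds, the root, and the rest
  of the structure; 6 expects a formula; 7, 8, 9 read the index of a proposition, after no digit,
  after a single 0, and after a leading 1. On malformed input the transducer emits 15, which
  does not occur in encodings of formulas.\<close>

definition ktok :: "nat \<Rightarrow> bool" where
  "ktok a \<longleftrightarrow> a \<le> 2 \<or> a = 14"

definition ftok :: "nat \<Rightarrow> bool" where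
  "ftok a \<longleftrightarrow> 3 \<le> a \<and> a \<le> 12"

text \<open>The symbol 12 opens the conjunction in the middle of a binary connective; the outputs
  for the two arguments then follow without a separator.\<close>

definition fstr :: "nat \<Rightarrow> nat list" where
  "fstr a = (if a = 3 then str (asg vx TZero)
     else if a \<in> {4, 7, 8, 9, 12} then str (un a)
     else str (bc a) @ 12 # str (bd a))"

definition knxt :: "nat \<Rightarrow> nat \<Rightarrow> nat" where
  "knxt p a = (if a = 2 \<and> p < 5 then p + 1 else p)"

definition nxt :: "nat \<Rightarrow> nat \<Rightarrow> nat" where
  "nxt p a = (if a = 17 then 1
     else if p = 0 then 2
     else if p = 2 \<and> a = 13 then 3
     else if p \<in> {3, 4, 5} \<and> ktok a then knxt p a
     else if p \<in> {5, 6} \<and> ftok a then (if a = 3 then 7 else 6)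
     else if p = 7 \<and> a \<le> 1 then 8 + a
     else if p = 9 \<and> a \<le> 1 then 9
     else if p \<in> {8, 9} \<and> a = 2 then 6
     else 1)"

context
  fixes pre :: "item list" and kits1 :: "nat \<Rightarrow> nat \<Rightarrow> item list" and fin :: "item list"
begin

definition out :: "nat \<Rightarrow> nat \<Rightarrow> nat list" where
  "out p a = (if p = 0 then str pre
     else if p = 2 \<and> a = 13 \<or> p = 6 \<and> a = 17 then []
     else if p \<in> {3, 4, 5} \<and> ktok a then str (kits1 p a)
     else if p = 5 \<and> ftok a then str fin @ fstr a
     else if p = 6 \<and> ftok a then fstr a
     else if p \<in> {7, 9} \<and> a \<le> 1 then str (pdig a)
     else if p \<in> {8, 9} \<and> a = 2 then enc_so pfin
     else [15])"

fun kits :: "nat \<Rightarrow> nat list \<Rightarrow> item list" where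
  "kits p [] = []"
| "kits p (a # u) = kits1 p a @ kits (knxt p a) u"

fun kph :: "nat \<Rightarrow> nat list \<Rightarrow> nat" where
  "kph p [] = p"
| "kph p (a # u) = kph (knxt p a) u"

abbreviation "run p z \<equiv> trun out nxt p (z @ [17])"

lemma computes: "\<exists>M. logspace_computes M 1 (\<lambda>w. trun out nxt 0 (16 # w @ [17]))"
proof (rule exI, rule tm_of_computes[where Q = 10])
  have s: "set (str c) \<subseteq> {..<16}" for c using set_str[of c] by fastforce
  have "set (fstr a) \<subseteq> {..<16}" for a using s by (simp add: fstr_def)
  moreover have "set (enc_so pfin) \<subseteq> {..<16}" using set_enc_so[of pfin] by fastforce
  ultimately show "set (out p a) \<subseteq> {..<16}" for p a
    using s by (simp add: out_def)
qed (simp_all add: nxt_def knxt_def)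

section \<open>Output on well-formed formulas\<close>

lemma run_pdigs:
  "set ds \<subseteq> {0, 1} \<Longrightarrow> trun out nxt 9 (ds @ z) = str (concat (map pdig ds)) @ trun out nxt 9 z"
  by (induction ds) (auto simp: out_def nxt_def ktok_def ftok_def)

lemma bin_foldl:
  "x \<noteq> 0 \<Longrightarrow> set ds \<subseteq> {0, 1} \<Longrightarrow> bin (foldl (\<lambda>x b. 2 * x + b) x ds) = bin x @ ds"
proof (induction ds arbitrary: x)
  case (Cons b ds)
  then show ?case using bin_step[of x b] by auto
qed simp

text \<open>These are the two ways of leaving phase 7: a single 0, or a numeral with leading
  1.\<close>

lemma bin_cases: "n = 0 \<and> bin n = [0] \<or> (\<exists>ds. set ds \<subseteq> {0, 1} \<and> bin n = 1 # ds)"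
proof (induction n rule: bin.induct)
  case (1 n)
  consider "n = 0" | "n = 1" | "n \<ge> 2" by linarith
  then show ?case
  proof cases
    case 3
    have "bin n = bin (n div 2) @ [n mod 2]" using 3 by (subst bin.simps) simp
    moreover obtain ds where "bin (n div 2) = 1 # ds" "set ds \<subseteq> {0, 1}" using 1 3 by auto
    ultimately show ?thesis by auto
  qed (auto simp: bin_less_2)
qed

lemma run_digit:
  "trun out nxt 7 (0 # z) = str (pdig 0) @ trun out nxt 8 z"
  "trun out nxt 7 (Suc 0 # z) = str (pdig 1) @ trun out nxt 9 z"
  "p \<in> {8, 9} \<Longrightarrow> trun out nxt p (2 # z) = enc_so pfin @ trun out nxt 6 z"
  by (auto simp: out_def nxt_def ktok_def ftok_def)

lemma run_enc_nat: "trun out nxt 7 (enc_nat p @ z) =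
  str (concat (map pdig (bin p))) @ enc_so pfin @ trun out nxt 6 z"
  using bin_cases[of p]
  by (elim disjE exE conjE) (simp_all add: enc_nat_def run_pdigs run_digit del: trun.simps)

lemma trun_6: "ftok a \<Longrightarrow> trun out nxt 6 (a # z) = fstr a @ trun out nxt (if a = 3 then 7 else 6) z"
  by (auto simp: out_def nxt_def ktok_def ftok_def)

text \<open>The translation concatenates the blocks of the input symbols in reading order and always
  returns to phase 6, so induction with an arbitrary remainder \<open>z\<close> suffices.\<close>

lemma run_enc_ltl: "trun out nxt 6 (enc_ltl \<phi> @ z) = enc_so (tr \<phi>) @ trun out nxt 6 z"
proof (induction \<phi> arbitrary: z)
  case (Prop p)
  then show ?case using run_enc_nat by (simp add: trun_6 ftok_def fstr_def enc_app del: trun.simps)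
qed (simp_all add: trun_6 ftok_def fstr_def enc_app bin_form_def del: trun.simps)

section \<open>Output on malformed input\<close>

text \<open>Two obstructions to encoding a formula: the error mark, and being a proper prefix of an
  encoding. Both persist when a context is put in front.\<close>

definition bad :: "nat list \<Rightarrow> bool" where
  "bad s \<longleftrightarrow> 15 \<in> set s \<or> (\<exists>e \<chi>. e \<noteq> [] \<and> s @ e = enc_so \<chi>)"

lemma bad_str:
  assumes "bad s"
  shows "bad (str c @ s)"
proof (cases "15 \<in> set s")
  case False
  then obtain e \<chi> where "e \<noteq> []" "s @ e = enc_so \<chi>" using assms bad_def by auto
  then have "e \<noteq> [] \<and> (str c @ s) @ e = enc_so (app c \<chi>)" by (simp add: enc_app)
  then show ?thesis unfolding bad_def by blast
qed (simp add: bad_def)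

lemma bad_enc_so: "bad s \<Longrightarrow> bad (12 # enc_so \<phi> @ s)"
  using bad_str[of s "[IAnd \<phi>]"] by simp

text \<open>If the left conjunct is incomplete, so is the conjunction, as its right conjunct is
  still missing.\<close>

lemma bad_left: "bad s \<Longrightarrow> bad (12 # s)"
proof -
  assume "bad s"
  \<comment> \<open>Any right conjunct completes the string; \<open>\<chi>\<close> itself is at
    hand, and its encoding is nonempty.\<close>
  moreover have "bad (12 # s)" if "s @ e = enc_so \<chi>" for e \<chi>
    unfolding bad_def
    by (intro disjI2 exI[of _ "e @ enc_so \<chi>"] exI[of _ "SAnd \<chi> \<chi>"])
      (use that[symmetric] in \<open>cases \<chi>; auto\<close>)
  ultimately show ?thesis unfolding bad_def by auto
qed

lemma bad_not_enc: "bad s \<Longrightarrow> s \<noteq> enc_so \<chi>"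
proof
  assume "bad s" and s: "s = enc_so \<chi>"
  moreover have "15 \<notin> set s" using set_enc_so[of \<chi>] s by auto
  ultimately obtain e \<chi>' where "e \<noteq> []" "enc_so \<chi> @ e = enc_so \<chi>' @ []" unfolding bad_def by auto
  then show False unfolding enc_so_prefix by simp
qed

lemma run_7: "(\<exists>p rest. z = enc_nat p @ rest) \<or> 15 \<in> set (run 7 z)"
proof -
  have 9: "(\<exists>ds rest. set ds \<subseteq> {0, 1} \<and> z = ds @ 2 # rest) \<or> 15 \<in> set (run 9 z)" for z
  proof (induction z)
    case (Cons a z)
    consider "a \<le> 1" | "a = 2" | "a > 2" by linarith
    then show ?case
    proof cases
      case 1
      from Cons show ?thesis
      proof
        assume "\<exists>ds rest. set ds \<subseteq> {0, 1} \<and> z = ds @ 2 # rest"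
        then obtain ds rest where "set ds \<subseteq> {0, 1}" "z = ds @ 2 # rest" by blast
        then have "set (a # ds) \<subseteq> {0, 1} \<and> a # z = (a # ds) @ 2 # rest" using 1 by auto
        then show ?thesis by blast
      qed (use 1 in \<open>simp add: nxt_def ktok_def ftok_def\<close>)
    next
      case 2
      then have "set [] \<subseteq> {0, 1} \<and> a # z = [] @ 2 # z" by simp
      then show ?thesis by blast
    qed (simp add: out_def)
  qed (simp add: out_def nxt_def ktok_def ftok_def)
  show ?thesis
  proof (cases z)
    case (Cons a y)
    consider "a = 0" | "a = 1" | "a > 1" by linarith
    then show ?thesis
    proof cases
      case 1
      show ?thesis
      proof (cases "\<exists>rest. y = 2 # rest")
        case True
        then obtain rest where "z = enc_nat 0 @ rest"
          using Cons 1 by (auto simp: enc_nat_def bin_less_2)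
        then show ?thesis by blast
      next
        case False
        then have "15 \<in> set (run 8 y)" by (cases y) (auto simp: out_def)
        then show ?thesis using Cons 1 by (simp add: nxt_def ktok_def ftok_def)
      qed
    next
      case 2
      show ?thesis using 9[of y]
      proof
        assume "\<exists>ds rest. set ds \<subseteq> {0, 1} \<and> y = ds @ 2 # rest"
        then obtain ds rest where ds: "set ds \<subseteq> {0, 1}" "y = ds @ 2 # rest" by blast
        then have "z = enc_nat (foldl (\<lambda>x b. 2 * x + b) 1 ds) @ rest"
          using bin_foldl[of 1 ds] Cons 2 by (simp add: enc_nat_def bin_less_2)
        then show ?thesis by blast
      qed (use 2 Cons in \<open>simp add: nxt_def ktok_def ftok_def\<close>)
    qed (use Cons in \<open>simp add: out_def\<close>)
  qed (simp add: out_def)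
qed

text \<open>Induction on the length, because the second argument of a binary connective starts
  wherever the first one ends.\<close>

lemma run_6: "set z \<subseteq> {..<16} \<Longrightarrow> (\<exists>\<phi> rest. z = enc_ltl \<phi> @ rest) \<or> bad (run 6 z)"
proof (induction "length z" arbitrary: z rule: less_induct)
  case less
  show ?case
  proof (cases z)
    case Nil
    \<comment> \<open>On empty input nothing is written, and the empty string is a proper prefix of
      every encoding.\<close>
    have "\<exists>e \<chi>. e \<noteq> [] \<and> e = enc_so \<chi>"
      by (rule exI[of _ "enc_so (Eq TZero TZero)"], rule exI[of _ "Eq TZero TZero"]) simp
    then show ?thesis using Nil by (simp add: out_def bad_def nxt_def)
  next
    case (Cons a y)
    have tok: "\<not> ftok a \<or> a = 3 \<or> a \<in> {4, 7, 8, 9, 12} \<or> a \<in> {5, 6, 10, 11}"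
      unfolding ftok_def insert_iff empty_iff by presburger
    consider "\<not> ftok a" | "a = 3" | "a \<in> {4, 7, 8, 9, 12}" | "a \<in> {5, 6, 10, 11}"
      using tok by blast
    then show ?thesis
    proof cases
      case 1
      \<comment> \<open>The bound on the symbols rules out 17, on which phase 6 would be
        silent.\<close>
      then show ?thesis using Cons less.prems by (auto simp: bad_def out_def)
    next
      case 2
      show ?thesis using run_7[of y]
      proof
        assume "\<exists>p rest. y = enc_nat p @ rest"
        then obtain p rest where "z = enc_ltl (Prop p) @ rest" using Cons 2 by auto
        then show ?thesis by blast
      qed (use Cons 2 in \<open>simp add: trun_6 ftok_def bad_def del: trun.simps\<close>)
    next
      case 3
      from less.hyps[of y] less.prems Cons consider \<phi> rest where "y = enc_ltl \<phi> @ rest" | "bad (run 6 y)" by auto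
      then show ?thesis
      proof cases
        case (1 \<phi> rest)
        then have "\<exists>\<psi>. z = enc_ltl \<psi> @ rest" using 3 Cons
          by (auto intro: exI[of _ "Neg \<phi>"] exI[of _ "Next \<phi>"] exI[of _ "Fin \<phi>"]
            exI[of _ "Glob \<phi>"] exI[of _ "Tilde \<phi>"])
        then show ?thesis by blast
      next
        case 2
        have "run 6 z = str (un a) @ run 6 y"
          using Cons 3 by (auto simp: trun_6 ftok_def fstr_def simp del: trun.simps)
        then show ?thesis using bad_str[OF 2] by simp
      qed
    next
      case 4
      have eq: "run 6 z = str (bc a) @ 12 # str (bd a) @ run 6 y"
        using Cons 4 by (auto simp: trun_6 ftok_def fstr_def simp del: trun.simps)
      from less.hyps[of y] less.prems Cons consider \<phi> rest where "y = enc_ltl \<phi> @ rest" | "bad (run 6 y)" by auto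
      then show ?thesis
      proof cases
        case (1 \<phi> rest)
        then have "length rest < length z" "set rest \<subseteq> {..<16}" using Cons less.prems by auto
        from less.hyps[OF this] show ?thesis
        proof
          assume "\<exists>\<psi> rest'. rest = enc_ltl \<psi> @ rest'"
          then obtain \<psi> rest' where "rest = enc_ltl \<psi> @ rest'" by blast
          then have "\<exists>\<chi>. z = enc_ltl \<chi> @ rest'" using 1 4 Cons
            by (auto intro: exI[of _ "Conj \<phi> \<psi>"] exI[of _ "Disj \<phi> \<psi>"] exI[of _ "Until \<phi> \<psi>"]
              exI[of _ "Release \<phi> \<psi>"])
          then show ?thesis by blast
        next
          assume "bad (run 6 rest)"
          then have "bad (str (bc a) @ 12 # enc_so (app (bd a) (tr \<phi>)) @ run 6 rest)"
            by (intro bad_str bad_enc_so)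
          then show ?thesis by (simp add: eq 1 run_enc_ltl enc_app)
        qed
      next
        case 2
        then show ?thesis unfolding eq by (intro disjI2 bad_str bad_left)
      qed
    qed
  qed
qed

text \<open>The first formula read already completes an encoding, so by unique readability nothing
  more is written. Every further input symbol would write something, hence no input is left.\<close>

lemma run_6_enc:
  assumes z16: "set z \<subseteq> {..<16}" and "str c @ run 6 z = enc_so \<chi>"
  shows "\<exists>\<phi>. z = enc_ltl \<phi>"
proof -
  have "\<not> bad (run 6 z)" using bad_str bad_not_enc assms(2) by blast
  then obtain \<phi> rest where z: "z = enc_ltl \<phi> @ rest" using run_6[OF z16] by blast
  then have "enc_so (app c (tr \<phi>)) @ run 6 rest = enc_so \<chi> @ []"
    using assms by (simp add: run_enc_ltl enc_app)
  then have r: "run 6 rest = []" unfolding enc_so_prefix by simp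
  have f: "fstr a \<noteq> []" for a by (auto simp: fstr_def asg_def un_def)
  have "rest = []"
  proof (cases rest)
    case (Cons a y)
    then show ?thesis using r f[of a] z z16 by (auto simp: out_def split: if_splits)
  qed
  then show ?thesis using z by auto
qed

lemma run_kits:
  "p \<in> {3, 4, 5} \<Longrightarrow> list_all ktok u \<Longrightarrow>
    trun out nxt p (u @ z) = str (kits p u) @ trun out nxt (kph p u) z \<and> kph p u \<in> {3, 4, 5}"
proof (induction u arbitrary: p)
  case (Cons a u)
  have "knxt p a \<in> {3, 4, 5}" using Cons.prems by (auto simp: knxt_def)
  moreover have "out p a = str (kits1 p a)" "nxt p a = knxt p a" "p \<noteq> 1"
    using Cons.prems by (auto simp: out_def nxt_def ktok_def)
  ultimately show ?case using Cons by simp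
qed auto

lemma run_5_fin: "ftok a \<Longrightarrow> trun out nxt 5 (a # z) = str fin @ trun out nxt 6 (a # z)"
  by (auto simp: out_def nxt_def ktok_def ftok_def)

lemma hd_enc_ltl: "\<exists>a z. enc_ltl \<phi> = a # z \<and> ftok a"
  by (cases \<phi>) (auto simp: ftok_def)

lemma transduce:
  assumes "list_all ktok u" "kph 3 u = 5"
  shows "trun out nxt 0 (16 # (13 # u @ enc_ltl \<phi>) @ [17]) = enc_so (app (pre @ kits 3 u @ fin) (tr \<phi>))"
proof -
  obtain a z where az: "enc_ltl \<phi> = a # z" "ftok a" using hd_enc_ltl by blast
  have "trun out nxt 0 (16 # (13 # u @ enc_ltl \<phi>) @ [17]) = str pre @ trun out nxt 3 (u @ enc_ltl \<phi> @ [17])"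
    by (simp add: out_def nxt_def)
  also have "trun out nxt 3 (u @ enc_ltl \<phi> @ [17]) = str (kits 3 u) @ trun out nxt 5 (enc_ltl \<phi> @ [17])"
    using run_kits[of 3 u] assms by simp
  also have "trun out nxt 5 (enc_ltl \<phi> @ [17]) = str fin @ trun out nxt 6 (enc_ltl \<phi> @ [17])"
    using az run_5_fin by simp
  also have "trun out nxt 6 (enc_ltl \<phi> @ [17]) = enc_so (tr \<phi>)"
    unfolding run_enc_ltl by (simp add: out_def)
  finally show ?thesis by (simp add: enc_app)
qed

lemma transduce_wellformed:
  assumes "set w \<subseteq> {..<16}" "trun out nxt 0 (16 # w @ [17]) = enc_so \<chi>"
  shows "\<exists>u \<phi>. w = 13 # u @ enc_ltl \<phi> \<and> list_all ktok u \<and> kph 3 u = 5"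
proof -
  have no15: "15 \<notin> set (trun out nxt 0 (16 # w @ [17]))" using assms(2) set_enc_so[of \<chi>] by auto
  have 0: "trun out nxt 0 (16 # w @ [17]) = str pre @ run 2 w"
    by (simp add: out_def nxt_def)
  have "15 \<notin> set (run 2 w)" using no15 unfolding 0 by simp
  then obtain y where w: "w = 13 # y"
    by (cases w) (auto simp: out_def split: if_splits)
  \<comment> \<open>Structure symbols and connectives are disjoint, so the formula must start after
    the longest run of structure symbols.\<close>
  define u where "u = takeWhile ktok y"
  define z where "z = dropWhile ktok y"
  have y: "y = u @ z" and u: "list_all ktok u"
    by (auto simp: u_def z_def list_all_iff dest: set_takeWhileD)
  have 3: "run 2 w = str (kits 3 u) @ run (kph 3 u) z" and ph: "kph 3 u \<in> {3, 4, 5}"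
    using run_kits[OF _ u, of 3 "z @ [17]"] by (simp_all add: w y out_def nxt_def)
  have z16: "set z \<subseteq> {..<16}" using assms(1) w y by simp
  have n: "15 \<notin> set (run (kph 3 u) z)" using no15 unfolding 0 3 by simp
  obtain a z' where z: "z = a # z'"
  proof (cases z)
    case Nil
    then show ?thesis using n ph by (auto simp: out_def ktok_def ftok_def)
  qed
  have a: "\<not> ktok a" using hd_dropWhile[of ktok y] z by (metis list.sel(1) list.distinct(1) z_def)
  have "kph 3 u = 5 \<and> ftok a" using n ph a by (auto simp: z out_def split: if_splits)
  then have "run (kph 3 u) z = str fin @ run 6 z" and 5: "kph 3 u = 5" using run_5_fin z by auto
  then have "str (pre @ kits 3 u @ fin) @ run 6 z = enc_so \<chi>" using assms(2) unfolding 0 3 by simp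
  then obtain \<phi> where "z = enc_ltl \<phi>" using run_6_enc[of z] z16 by blast
  then show ?thesis using w y u 5 by auto
qed

end

section \<open>Reading a Kripke structure\<close>

text \<open>A state consists of the number of worlds and the root (set to 0 until both are known),
  the number of matrix entries read, the value of the current number, whether it has a digit,
  the strict upper bound of the labels of the current world read so far, the current world, and the
  pending number of worlds. \<open>E\<close> and \<open>L\<close> are guessed in advance and compared with the input.\<close>

type_synonym kstate = "nat \<times> nat \<times> nat \<times> nat \<times> nat \<times> nat \<times> nat \<times> nat"

context
  fixes E :: "nat \<Rightarrow> bool" and L :: "nat \<Rightarrow> nat \<Rightarrow> bool"
begin

text \<open>While \<open>n = 0\<close> no matrix entry is pending, so digits in phases 3 and 4
  belong to numbers; \<open>d = 0 \<or> x \<noteq> 0\<close> forbids leading zeros. A label must be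
  the least one from \<open>l\<close> on, and 14 demands that none remain, which forces the sorted
  list without omissions.\<close>

definition kcond :: "nat \<Rightarrow> nat \<Rightarrow> kstate \<Rightarrow> bool" where
  "kcond p a = (\<lambda>(n, r, m, x, d, l, i, q).
     if a \<le> 1 then (if m < n * n then E m = (a = 1) else d = 0 \<or> x \<noteq> 0)
     else if a = 2 then d \<noteq> 0 \<and>
       (p < 5 \<or> n * n \<le> m \<and> l \<le> x \<and> L i x \<and> (\<forall>y. l \<le> y \<and> y < x \<longrightarrow> \<not> L i y))
     else p = 5 \<and> n * n \<le> m \<and> d = 0 \<and> (\<forall>y. l \<le> y \<longrightarrow> \<not> L i y))"

text \<open>The number of worlds waits in the last component until the root is read, since a
  positive \<open>n\<close> would turn the digits of the root into matrix entries.\<close>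

definition kupd :: "nat \<Rightarrow> nat \<Rightarrow> kstate \<Rightarrow> kstate" where
  "kupd p a = (\<lambda>(n, r, m, x, d, l, i, q).
     if a \<le> 1 then (if m < n * n then (n, r, m + 1, x, d, l, i, q)
       else (n, r, m, 2 * x + a, 1, l, i, q))
     else if a = 2 then
       (if p = 3 then (n, r, m, 0, 0, l, i, x)
        else if p = 4 then (q, x, m, 0, 0, l, i, q)
        else (n, r, m, 0, 0, x + 1, i, q))
     else (n, r, m, x, d, 0, i + 1, q))"

fun krun :: "nat \<Rightarrow> nat list \<Rightarrow> kstate \<Rightarrow> (nat \<times> kstate) option" where
  "krun p [] s = Some (p, s)"
| "krun p (a # u) s = (if kcond p a s then krun (knxt p a) u (kupd p a s) else None)"

lemma krun_kph: "krun p u s = Some (p', s') \<Longrightarrow> kph p u = p'"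
  by (induction u arbitrary: p s) (auto split: if_splits)

section \<open>The canonical code and soundness of the reader\<close>

definition labels :: "nat \<Rightarrow> nat list" where
  "labels i = concat (map enc_nat (sorted_list_of_set {p. L i p})) @ [14]"

definition kcode :: "nat \<Rightarrow> nat \<Rightarrow> nat list" where
  "kcode n r = enc_nat n @ enc_nat r @ map (\<lambda>k. if E k then 1 else 0) [0..<n * n] @
    concat (map labels [0..<n])"

text \<open>The flag separates an empty numeral from the digit 0; both have value 0.\<close>

definition digs :: "nat \<Rightarrow> nat \<Rightarrow> nat list" where
  "digs d x = (if d = 0 then [] else bin x)"

text \<open>The invariant recovers the consumed input \<open>u\<close> from the state and the
  guessed sets: finished numbers, matrix entries, finished worlds, labels below \<open>l\<close>,
  pending digits.\<close>

definition kinv :: "nat \<Rightarrow> nat list \<Rightarrow> kstate \<Rightarrow> bool" where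
  "kinv p u = (\<lambda>(n, r, m, x, d, l, i, q). (d = 0 \<longrightarrow> x = 0) \<and>
    (if p = 3 then n = 0 \<and> m = 0 \<and> l = 0 \<and> i = 0 \<and> u = digs d x
     else if p = 4 then n = 0 \<and> m = 0 \<and> l = 0 \<and> i = 0 \<and> u = enc_nat q @ digs d x
     else p = 5 \<and> m \<le> n * n \<and> (m < n * n \<longrightarrow> i = 0 \<and> l = 0 \<and> d = 0) \<and>
       (\<forall>j<i. finite {p. L j p}) \<and>
       u = enc_nat n @ enc_nat r @ map (\<lambda>k. if E k then 1 else 0) [0..<m] @
         concat (map labels [0..<i]) @ concat (map enc_nat (filter (L i) [0..<l])) @ digs d x))"

lemma digs_step: "d = 0 \<or> x \<noteq> 0 \<Longrightarrow> (d = 0 \<longrightarrow> x = 0) \<Longrightarrow> b < 2 \<Longrightarrow> digs 1 (2 * x + b) = digs d x @ [b]"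
  by (auto simp: digs_def bin_step bin_less_2)

lemma filter_step:
  assumes "l \<le> x" "L i x" "\<forall>y. l \<le> y \<and> y < x \<longrightarrow> \<not> L i y"
  shows "filter (L i) [0..<Suc x] = filter (L i) [0..<l] @ [x]"
proof -
  have "[0..<x + 1] = [0..<l] @ [l..<x] @ [x]" 
    using assms(1) upt_add_eq_append[of 0 l "x - l"] by simp
  moreover have "filter (L i) [l..<x] = []" using assms(3) by (auto simp: filter_empty_conv)
  ultimately show ?thesis using assms(2) by simp
qed

text \<open>The end of a label list thus also certifies that the guessed label set is
  finite.\<close>

lemma filter_all:
  assumes "\<forall>y. l \<le> y \<longrightarrow> \<not> L i y"
  shows "finite {p. L i p} \<and> filter (L i) [0..<l] = sorted_list_of_set {p. L i p}"
proof -
  have eq: "{p. L i p} = set (filter (L i) [0..<l])" using assms by (auto; metis not_le)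
  have "sorted_list_of_set (set (filter (L i) [0..<l])) = filter (L i) [0..<l]"
    by (rule sorted_list_of_set.idem_if_sorted_distinct) (simp_all add: sorted_wrt_filter)
  then show ?thesis using eq by (metis List.finite_set)
qed

lemma kinv_step:
  assumes inv: "kinv p u s" and c: "kcond p a s" and a: "ktok a"
  shows "kinv (knxt p a) (u @ [a]) (kupd p a s)"
proof -
  obtain n r m x d l i q where s: "s = (n, r, m, x, d, l, i, q)" by (metis prod_cases5 surj_pair)
  have dx: "d = 0 \<longrightarrow> x = 0" and p: "p \<in> {3, 4, 5}" using inv by (auto simp: kinv_def s split: if_splits)
  consider "a \<le> 1" "m < n * n" | "a \<le> 1" "\<not> m < n * n" | "a = 2" | "a = 14"
    using a unfolding ktok_def by linarith
  then show ?thesis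
  proof cases
    case 1
    \<comment> \<open>The earlier phases have \<open>n = 0\<close> and so no matrix entry to
      read.\<close>
    then have 5: "p = 5" using inv p by (auto simp: kinv_def s)
    have E: "(if E m then 1 else 0) = a" using c 1 by (auto simp: kcond_def s)
    show ?thesis using 1 inv unfolding 5
      by (simp add: kinv_def s kupd_def knxt_def digs_def E)
  next
    case 2
    then have "d = 0 \<or> x \<noteq> 0" using c by (simp add: kcond_def s)
    then have "digs 1 (2 * x + a) = digs d x @ [a]" using digs_step dx 2 by simp
    moreover have "knxt p a = p" "kupd p a s = (n, r, m, 2 * x + a, 1, l, i, q)"
      using 2 by (simp_all add: knxt_def kupd_def s)
    ultimately show ?thesis using 2 inv p by (simp add: kinv_def s)
  next
    case 3
    then have d: "digs d x @ [2] = enc_nat x" using c by (simp add: kcond_def s digs_def enc_nat_def)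
    show ?thesis
    proof (cases "p = 5")
      case True
      then have "filter (L i) [0..<Suc x] = filter (L i) [0..<l] @ [x]" "n * n \<le> m"
        using c 3 filter_step[of l x i] by (simp_all add: kcond_def s)
      then show ?thesis using 3 inv True d
        by (simp add: kinv_def s kupd_def knxt_def digs_def[of 0] del: upt_Suc)
    next
      case False
      then consider "p = 3" | "p = 4" using p by blast
      then show ?thesis
        using 3 inv d by cases (simp_all add: kinv_def s kupd_def knxt_def digs_def[of 0])
    qed
  next
    case 4
    then have 5: "p = 5" "n * n \<le> m" "d = 0" "\<forall>y. l \<le> y \<longrightarrow> \<not> L i y" using c by (simp_all add: kcond_def s)
    show ?thesis using 4 5(2,3) inv filter_all[OF 5(4)] unfolding 5(1)
      by (simp add: kinv_def s kupd_def knxt_def digs_def labels_def less_Suc_eq)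
  qed
qed

lemma krun_sound:
  "kinv p u s \<Longrightarrow> list_all ktok u' \<Longrightarrow> krun p u' s = Some (p', s') \<Longrightarrow> kinv p' (u @ u') s'"
proof (induction u' arbitrary: p u s)
  case (Cons a u')
  then have "kcond p a s" "krun (knxt p a) u' (kupd p a s) = Some (p', s')" by (auto split: if_splits)
  then show ?case using Cons.IH[OF kinv_step[OF Cons.prems(1)]] Cons.prems(2) by fastforce
qed simp

lemma krun_sound_code:
  assumes "list_all ktok u" "krun 3 u (0, 0, 0, 0, 0, 0, 0, 0) = Some (5, n, r, n * n, x, 0, 0, n, q)"
  shows "u = kcode n r" "\<forall>j<n. finite {p. L j p}"
proof -
  have "kinv 3 [] (0, 0, 0, 0, 0, 0, 0, 0)" by (simp add: kinv_def digs_def)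
  from krun_sound[OF this assms] show "u = kcode n r" "\<forall>j<n. finite {p. L j p}"
    by (simp_all add: kinv_def kcode_def digs_def)
qed

section \<open>Completeness of the reader\<close>

lemma krun_bin:
  "n * n \<le> m \<Longrightarrow> krun p (bin k @ z) (n, r, m, 0, 0, l, i, q) = krun p z (n, r, m, k, 1, l, i, q)"
proof (induction k arbitrary: z rule: bin.induct)
  case (1 k)
  show ?case
  proof (cases "k < 2")
    case True
    then show ?thesis using 1(2) by (simp add: bin_less_2 kcond_def kupd_def knxt_def)
  next
    case False
    then have "bin k = bin (k div 2) @ [k mod 2]" by (subst bin.simps) simp
    moreover have "k mod 2 \<le> Suc 0" by simp
    ultimately show ?thesis using 1 False
      by (simp add: kcond_def kupd_def knxt_def)
  qed
qed

lemma krun_matrix: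
  "m \<le> n * n \<Longrightarrow> krun 5 (map (\<lambda>k. if E k then 1 else 0) [m..<n * n] @ z) (n, r, m, 0, 0, 0, 0, q) =
    krun 5 z (n, r, n * n, 0, 0, 0, 0, q)"
proof (induction "n * n - m" arbitrary: m)
  case (Suc k)
  then have m: "m < n * n" by simp
  then have "[m..<n * n] = m # [Suc m..<n * n]" by (simp add: upt_conv_Cons)
  then show ?case using Suc(1)[of "Suc m"] Suc(2) m by (simp add: kcond_def kupd_def knxt_def)
qed simp

text \<open>The bound \<open>l\<close> is generalised: behind a label \<open>x\<close>, the rest of
  the list enumerates the labels from \<open>x + 1\<close> on.\<close>

lemma krun_labels:
  assumes "n * n \<le> m"
  shows "sorted_wrt (<) xs \<Longrightarrow> set xs = {p. L i p \<and> l \<le> p} \<Longrightarrow>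
    krun 5 (concat (map enc_nat xs) @ 14 # z) (n, r, m, 0, 0, l, i, q) =
    krun 5 z (n, r, m, 0, 0, 0, i + 1, q)"
proof (induction xs arbitrary: l)
  case Nil
  then have "\<forall>y. l \<le> y \<longrightarrow> \<not> L i y" by auto
  then show ?case using assms by (simp add: kcond_def kupd_def knxt_def)
next
  case (Cons x xs)
  have mem: "L i p \<and> l \<le> p \<longleftrightarrow> p = x \<or> p \<in> set xs" for p using Cons.prems(2) by auto
  have less: "p \<in> set xs \<Longrightarrow> x < p" for p using Cons.prems(1) by simp
  have x: "L i x" "l \<le> x" using mem[of x] by simp_all
  have gap: "\<forall>y. l \<le> y \<and> y < x \<longrightarrow> \<not> L i y" using mem less by (metis less_asym less_irrefl)
  have "set xs = {p. L i p \<and> x + 1 \<le> p}"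
  proof (rule set_eqI)
    fix p
    show "p \<in> set xs \<longleftrightarrow> p \<in> {p. L i p \<and> x + 1 \<le> p}"
      using mem[of p] less[of p] x(2) by auto
  qed
  then have "krun 5 (concat (map enc_nat xs) @ 14 # z) (n, r, m, 0, 0, x + 1, i, q) =
    krun 5 z (n, r, m, 0, 0, 0, i + 1, q)" by (intro Cons.IH) (use Cons.prems(1) in simp_all)
  then show ?case using assms x gap
    by (simp add: enc_nat_def[of x] krun_bin) (simp add: kcond_def kupd_def knxt_def)
qed

lemma krun_worlds:
  assumes "n * n \<le> m"
  shows "i \<le> n \<Longrightarrow> \<forall>j<n. finite {p. L j p} \<Longrightarrow>
    krun 5 (concat (map labels [i..<n]) @ z) (n, r, m, 0, 0, 0, i, q) = krun 5 z (n, r, m, 0, 0, 0, n, q)"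
proof (induction "n - i" arbitrary: i)
  case (Suc k)
  then have i: "i < n" by simp
  then have "[i..<n] = i # [Suc i..<n]" by (simp add: upt_conv_Cons)
  moreover have "krun 5 (labels i @ z) (n, r, m, 0, 0, 0, i, q) = krun 5 z (n, r, m, 0, 0, 0, i + 1, q)" for z
    unfolding labels_def using krun_labels[OF assms, of "sorted_list_of_set {p. L i p}" i 0] Suc.prems i
    by simp
  ultimately show ?case using Suc(1)[of "Suc i"] Suc(2) Suc.prems i by simp
qed simp

lemma krun_complete:
  assumes "\<forall>j<n. finite {p. L j p}"
  shows "krun 3 (kcode n r) (0, 0, 0, 0, 0, 0, 0, 0) = Some (5, n, r, n * n, 0, 0, 0, n, n)"
proof -
  have 3: "krun 3 (enc_nat n @ z) (0, 0, 0, 0, 0, 0, 0, 0) = krun 4 z (0, 0, 0, 0, 0, 0, 0, n)" for z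
    by (simp add: enc_nat_def krun_bin) (simp add: kcond_def kupd_def knxt_def)
  have 4: "krun 4 (enc_nat r @ z) (0, 0, 0, 0, 0, 0, 0, n) = krun 5 z (n, r, 0, 0, 0, 0, 0, n)" for z
    by (simp add: enc_nat_def krun_bin) (simp add: kcond_def kupd_def knxt_def)
  show ?thesis
    using krun_matrix[of 0 n] krun_worlds[of n "n * n" 0 "[]"] assms by (simp add: kcode_def 3 4)
qed

lemma ktok_kcode: "list_all ktok (kcode n r)"
proof -
  have "list_all ktok (enc_nat k)" for k using set_enc_nat[of k] by (auto simp: list_all_iff ktok_def)
  then show ?thesis by (auto simp: kcode_def labels_def list_all_iff ktok_def)
qed

end

section \<open>Kripke structures from a row-major matrix and a labelling\<close>

definition kripke_of :: "(nat \<Rightarrow> bool) \<Rightarrow> (nat \<Rightarrow> nat \<Rightarrow> bool) \<Rightarrow> nat \<Rightarrow> nat \<Rightarrow> kripke" where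
  "kripke_of E L n r = \<lparr>nW = n, rel = {(i, j). i < n \<and> j < n \<and> E (i * n + j)},
     lab = (\<lambda>i. {p. L i p}), rt = r\<rparr>"

lemma concat_matrix:
  "concat (map (\<lambda>i. map (\<lambda>j. g (i * n + j)) [0..<n]) [0..<k]) = map g [0..<k * n]"
proof (induction k)
  case (Suc k)
  have "map (\<lambda>j. g (k * n + j)) [0..<n] = map g [k * n..<k * n + n]"
    by (rule nth_equalityI) auto
  moreover have "[0..<k * n + n] = [0..<k * n] @ [k * n..<k * n + n]"
    by (rule upt_add_eq_append) simp
  ultimately have "map g [0..<k * n + n] = map g [0..<k * n] @ map (\<lambda>j. g (k * n + j)) [0..<n]"
    by (metis map_append)
  then show ?case using Suc by (simp add: add.commute[of n])
qed simp

lemma enc_kripke_of: "enc_kripke (kripke_of E L n r) = 13 # kcode E L n r"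
proof -
  have "concat (map (\<lambda>i. map (\<lambda>j. if (i, j) \<in> rel (kripke_of E L n r) then 1 else 0 :: nat) [0..<n]) [0..<n]) =
      concat (map (\<lambda>i. map (\<lambda>j. if E (i * n + j) then 1 else 0) [0..<n]) [0..<n])"
    by (intro arg_cong[where f = concat] map_cong) (auto simp: kripke_of_def)
  then show ?thesis
    using concat_matrix[of "\<lambda>k. if E k then 1 else 0" n n]
    by (simp add: enc_kripke_def kcode_def labels_def[abs_def] kripke_of_def)
qed

text \<open>Division with remainder by the number of worlds recovers the pair from its matrix
  index.\<close>

lemma kripke_of_surj:
  assumes "wf_kripke K"
  obtains E L where "kripke_of E L (nW K) (rt K) = K" "\<forall>j<nW K. finite {p. L j p}"
proof
  let ?n = "nW K"
  have "rel K = {(i, j). i < ?n \<and> j < ?n \<and> (((i * ?n + j) div ?n, (i * ?n + j) mod ?n) \<in> rel K)}"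
    using assms by (auto simp: wf_kripke_def)
  then show "kripke_of (\<lambda>k. (k div ?n, k mod ?n) \<in> rel K) (\<lambda>i p. p \<in> lab K i) ?n (rt K) = K"
    by (simp add: kripke_of_def)
  show "\<forall>j<?n. finite {p. p \<in> lab K j}"
    using assms by (simp add: wf_kripke_def)
qed

section \<open>The reader as a formula\<close>

text \<open>A case distinction would duplicate the hole. Instead \<open>vc\<close> and
  \<open>ve\<close> are complementary 0-1 indicators of reading the matrix or a number, and the
  updates are arithmetic combinations of both cases.\<close>

definition digit_items :: "nat \<Rightarrow> item list" where
  "digit_items b =
    (let lt = Lt (TVar vm) (TTimes (TVar vn) (TVar vn));
         t = (if b = 0 then TZero else TOne) in
     [IEx1 vc, IAnd (SOr (SAnd lt (Eq (TVar vc) TOne)) (SAnd (SNot lt) (Eq (TVar vc) TZero))),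
      IEx1 ve, IAnd (SOr (SAnd lt (Eq (TVar ve) TZero)) (SAnd (SNot lt) (Eq (TVar ve) TOne))),
      IAnd (SImp lt (if b = 0 then SNot (M1 VE (TVar vm)) else M1 VE (TVar vm))),
      IAnd (SOr lt (SOr (Eq (TVar vd) TZero) (SNot (Eq (TVar vx) TZero))))] @
     asg vm (TPlus (TVar vm) (TVar vc)) @
     asg vx (TPlus (TTimes (TVar vc) (TVar vx))
       (TTimes (TVar ve) (TPlus (TPlus (TVar vx) (TVar vx)) t))) @
     asg vd (TPlus (TTimes (TVar vc) (TVar vd)) (TVar ve)))"

text \<open>The false equation \<open>0 = 1\<close> rejects an end of world before phase 5.\<close>

definition kits1 :: "nat \<Rightarrow> nat \<Rightarrow> item list" where
  "kits1 p a =
    (let full = Le (TTimes (TVar vn) (TVar vn)) (TVar vm);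
         digit = SNot (Eq (TVar vd) TZero);
         reset = asg vx TZero @ asg vd TZero in
     if a \<le> 1 then digit_items a
     else if a = 2 then
       IAnd digit # (if p = 3 then asg vp (TVar vx)
         else if p = 4 then asg vn (TVar vp) @ asg vr (TVar vx)
         else [IAnd full, IAnd (Le (TVar vl) (TVar vx)), IAnd (M2 VL (TVar vi) (TVar vx)),
           IAnd (All1 va (SImp (SAnd (Le (TVar vl) (TVar va)) (Lt (TVar va) (TVar vx)))
             (SNot (M2 VL (TVar vi) (TVar va)))))] @ asg vl (TPlus (TVar vx) TOne)) @ reset
     else [IAnd (if p = 5 then Eq TZero TZero else Eq TZero TOne), IAnd full,
         IAnd (Eq (TVar vd) TZero),
         IAnd (All1 va (SImp (Le (TVar vl) (TVar va)) (SNot (M2 VL (TVar vi) (TVar va)))))] @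
       asg vi (TPlus (TVar vi) TOne) @ asg vl TZero)"

definition st :: "(nat \<Rightarrow> nat) \<Rightarrow> kstate" where
  "st v = (v vn, v vr, v vm, v vx, v vd, v vl, v vi, v vp)"

definition Eof :: "(nat \<Rightarrow> nat \<Rightarrow> nat list set) \<Rightarrow> nat \<Rightarrow> bool" where
  "Eof V k \<longleftrightarrow> [k] \<in> V VE ar1"

definition Lof :: "(nat \<Rightarrow> nat \<Rightarrow> nat list set) \<Rightarrow> nat \<Rightarrow> nat \<Rightarrow> bool" where
  "Lof V i p \<longleftrightarrow> [i, p] \<in> V VL ar2"

lemma sosat_digit_matrix:
  assumes "v vm < v vn * v vn"
  shows "\<exists>v'. st v' = (v vn, v vr, v vm + 1, v vx, v vd, v vl, v vi, v vp) \<and>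
    (\<forall>h. sosat v V (app (digit_items b) h) \<longleftrightarrow> Eof V (v vm) = (b \<noteq> 0) \<and> sosat v' V h)"
proof (intro exI conjI allI)
  fix h
  show "sosat v V (app (digit_items b) h) \<longleftrightarrow> Eof V (v vm) = (b \<noteq> 0) \<and>
    sosat (v(vc := 1, ve := 0, vt := v vm + 1, vm := v vm + 1, vt := v vx, vx := v vx,
      vt := v vd, vd := v vd)) V h"
    using assms by (simp add: digit_items_def Let_def Eof_def)
qed (simp add: st_def)

lemma sosat_digit_number:
  assumes "\<not> v vm < v vn * v vn" "b \<le> 1"
  shows "\<exists>v'. st v' = (v vn, v vr, v vm, 2 * v vx + b, 1, v vl, v vi, v vp) \<and>
    (\<forall>h. sosat v V (app (digit_items b) h) \<longleftrightarrow> (v vd = 0 \<or> v vx \<noteq> 0) \<and> sosat v' V h)"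
proof (intro exI conjI allI)
  fix h
  have "b = 0 \<or> b = 1" using assms by auto
  then show "sosat v V (app (digit_items b) h) \<longleftrightarrow> (v vd = 0 \<or> v vx \<noteq> 0) \<and>
    sosat (v(vc := 0, ve := 1, vt := v vm, vm := v vm, vt := 2 * v vx + b, vx := 2 * v vx + b,
      vt := 1, vd := 1)) V h"
    using assms by (auto simp: digit_items_def Let_def mult_2)
qed (simp add: st_def)

lemma sosat_kits1:
  assumes a: "ktok a" and p: "p \<in> {3, 4, 5}"
  shows "\<exists>v'. st v' = kupd p a (st v) \<and>
    (\<forall>h. sosat v V (app (kits1 p a) h) \<longleftrightarrow> kcond (Eof V) (Lof V) p a (st v) \<and> sosat v' V h)"
proof -
  consider "a \<le> 1" "v vm < v vn * v vn" | "a \<le> 1" "\<not> v vm < v vn * v vn"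
    | "a = 2" "p = 3" | "a = 2" "p = 4" | "a = 2" "p = 5" | "a = 14"
    using assms unfolding ktok_def by fastforce
  then show ?thesis
  proof cases
    case 1
    then have "(a = 1) = (a \<noteq> 0)" by auto
    then show ?thesis using sosat_digit_matrix[of v V a] 1
      by (simp add: kits1_def kcond_def kupd_def st_def)
  next
    case 2
    then show ?thesis using sosat_digit_number[of v a V]
      by (simp add: kits1_def kcond_def kupd_def st_def)
  next
    case 3
    show ?thesis
      \<comment> \<open>The witness lists the assignments in order of execution, including the
        traffic through \<open>vt\<close>.\<close>
      by (rule exI[of _ "v(vt := v vx, vp := v vx, vt := 0, vx := 0, vt := 0, vd := 0)"])
        (simp add: 3 kits1_def kcond_def kupd_def st_def Let_def)
  next
    case 4
    show ?thesis
      by (rule exI[of _ "v(vt := v vp, vn := v vp, vt := v vx, vr := v vx, vt := 0, vx := 0, vt := 0, vd := 0)"])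
        (simp add: 4 kits1_def kcond_def kupd_def st_def Let_def)
  next
    case 5
    show ?thesis
      by (rule exI[of _ "v(vt := v vx + 1, vl := v vx + 1, vt := 0, vx := 0, vt := 0, vd := 0)"])
        (simp add: 5 kits1_def kcond_def kupd_def st_def Let_def Lof_def conj_assoc)
  next
    case 6
    show ?thesis
      by (rule exI[of _ "v(vt := v vi + 1, vi := v vi + 1, vt := 0, vl := 0)"])
        (simp add: 6 kits1_def kcond_def kupd_def st_def Let_def Lof_def)
  qed
qed

lemma sosat_kits:
  assumes "list_all ktok u" "p \<in> {3, 4, 5}"
  shows "case krun (Eof V) (Lof V) p u (st v) of
      None \<Rightarrow> \<forall>h. \<not> sosat v V (app (kits kits1 p u) h)
    | Some (p', s) \<Rightarrow> \<exists>v'. st v' = s \<and> (\<forall>h. sosat v V (app (kits kits1 p u) h) = sosat v' V h)"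
  using assms
proof (induction u arbitrary: p v)
  case (Cons a u)
  obtain v' where v': "st v' = kupd p a (st v)"
    "\<forall>h. sosat v V (app (kits1 p a) h) \<longleftrightarrow> kcond (Eof V) (Lof V) p a (st v) \<and> sosat v' V h"
    using sosat_kits1[of a p v V] Cons.prems by auto
  have "knxt p a \<in> {3, 4, 5}" using Cons.prems by (auto simp: knxt_def)
  then have "case krun (Eof V) (Lof V) (knxt p a) u (st v') of
      None \<Rightarrow> \<forall>h. \<not> sosat v' V (app (kits kits1 (knxt p a) u) h)
    | Some (p', s) \<Rightarrow> \<exists>w. st w = s \<and> (\<forall>h. sosat v' V (app (kits kits1 (knxt p a) u) h) = sosat w V h)"
    using Cons by simp
  then show ?case using v' by (auto split: option.splits)
qed auto

lemma fv_kits1: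
  assumes "fv1 h \<subseteq> {vn, vr, vm, vx, vd, vl, vi, vp}" "fv2 h \<subseteq> {(VE, ar1), (VL, ar2)}"
  shows "fv1 (app (kits1 p a) h) \<subseteq> {vn, vr, vm, vx, vd, vl, vi, vp}"
    "fv2 (app (kits1 p a) h) \<subseteq> {(VE, ar1), (VL, ar2)}"
  using assms by (auto simp: kits1_def digit_items_def Let_def fv_asg)

lemma fv_kits:
  assumes "fv1 h \<subseteq> {vn, vr, vm, vx, vd, vl, vi, vp}" "fv2 h \<subseteq> {(VE, ar1), (VL, ar2)}"
  shows "fv1 (app (kits kits1 p u) h) \<subseteq> {vn, vr, vm, vx, vd, vl, vi, vp} \<and>
    fv2 (app (kits kits1 p u) h) \<subseteq> {(VE, ar1), (VL, ar2)}"
  by (induction u arbitrary: p) (simp_all add: assms fv_kits1 del: insert_subset)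

definition zero :: "nat \<Rightarrow> item list" where
  "zero x = [IEx1 x, IAnd (Eq (TVar x) TZero)]"

definition pre :: "item list" where
  "pre = [IEx2 VE ar1, IEx2 VL ar2] @ zero vn @ zero vr @ zero vm @ zero vx @ zero vd @ zero vl @
    zero vi @ zero vp"

lemma sosat_pre:
  "sosat v V (app pre h) \<longleftrightarrow> (\<exists>S S'. S \<subseteq> {xs. length xs = ar1} \<and> S' \<subseteq> {xs. length xs = ar2} \<and>
    sosat (v(vn := 0, vr := 0, vm := 0, vx := 0, vd := 0, vl := 0, vi := 0, vp := 0))
      (V(VE := (V VE)(ar1 := S), VL := (V VL)(ar2 := S'))) h)"
  by (simp add: pre_def zero_def)

lemma fv_pre:
  "fv1 (app pre h) = fv1 h - {vn, vr, vm, vx, vd, vl, vi, vp}"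
  "fv2 (app pre h) = fv2 h - {(VE, ar1), (VL, ar2)}"
  by (auto simp: pre_def zero_def)

section \<open>The team of a Kripke structure\<close>

definition dec :: "nat list set \<Rightarrow> trace" where
  "dec S = (\<lambda>j. {p. [j, p] \<in> S})"

lemma dec_surj: "\<exists>S. S \<subseteq> {xs. length xs = ar2} \<and> dec S = t"
  by (rule exI[of _ "{[j, p] | j p. p \<in> t j}"]) (auto simp: dec_def)

text \<open>\<open>VP\<close> is a total relation from times to worlds. Each further condition
  constrains all worlds related to a time, so every choice function for \<open>VP\<close> is a path
  with trace \<open>VX\<close>.\<close>

definition path_form :: soform where
  "path_form = Ex2 VP ar2 (SAnd (All1 vj (Ex1 va (M2 VP (TVar vj) (TVar va))))
    (SAnd (All1 va (SImp (M2 VP TZero (TVar va)) (Eq (TVar va) (TVar vr))))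
    (SAnd (All1 vj (All1 va (All1 vb (SImp
        (SAnd (M2 VP (TVar vj) (TVar va)) (M2 VP (TPlus (TVar vj) TOne) (TVar vb)))
        (SAnd (Lt (TVar va) (TVar vn)) (SAnd (Lt (TVar vb) (TVar vn))
          (M1 VE (TPlus (TTimes (TVar va) (TVar vn)) (TVar vb)))))))))
    (All1 vj (All1 va (SImp (M2 VP (TVar vj) (TVar va))
        (All1 vb (SIff (M2 VX (TVar vj) (TVar vb)) (M2 VL (TVar va) (TVar vb))))))))))"

lemma sosat_path_form:
  "sosat v V path_form \<longleftrightarrow>
    dec (V VX ar2) \<in> team_of (kripke_of (Eof V) (Lof V) (v vn) (v vr))" (is "?l \<longleftrightarrow> ?r")
proof
  assume ?l
  then obtain P where P: "\<forall>j. \<exists>w. [j, w] \<in> P" "\<forall>w. [0, w] \<in> P \<longrightarrow> w = v vr"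
    "\<forall>j w w'. [j, w] \<in> P \<and> [j + 1, w'] \<in> P \<longrightarrow> w < v vn \<and> w' < v vn \<and> Eof V (w * v vn + w')"
    "\<forall>j w. [j, w] \<in> P \<longrightarrow> (\<forall>p. [j, p] \<in> V VX ar2 \<longleftrightarrow> Lof V w p)"
    by (auto simp: path_form_def Eof_def Lof_def)
  obtain \<pi> where \<pi>: "\<And>j. [j, \<pi> j] \<in> P" using P(1) by metis
  have "is_path (kripke_of (Eof V) (Lof V) (v vn) (v vr)) \<pi>"
  proof -
    have "\<pi> i < v vn \<and> \<pi> (i + 1) < v vn \<and> Eof V (\<pi> i * v vn + \<pi> (i + 1))" for i
      using P(3) \<pi> by blast
    moreover have "\<pi> 0 = v vr" using P(2) \<pi> by blast
    ultimately show ?thesis by (simp add: is_path_def kripke_of_def)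
  qed
  moreover have "dec (V VX ar2) = (\<lambda>i. lab (kripke_of (Eof V) (Lof V) (v vn) (v vr)) (\<pi> i))"
    using P(4) \<pi> by (auto simp: dec_def kripke_of_def)
  ultimately show ?r unfolding team_of_def by blast
next
  assume ?r
  then obtain \<pi> where \<pi>: "is_path (kripke_of (Eof V) (Lof V) (v vn) (v vr)) \<pi>"
    "dec (V VX ar2) = (\<lambda>i. lab (kripke_of (Eof V) (Lof V) (v vn) (v vr)) (\<pi> i))"
    unfolding team_of_def by blast
  have X: "[j, p] \<in> V VX ar2 \<longleftrightarrow> Lof V (\<pi> j) p" for j p
    using fun_cong[OF \<pi>(2), of j] by (auto simp: dec_def kripke_of_def)
  let ?P = "{[j, \<pi> j] | j. True}"
  have P: "[j, w] \<in> ?P \<longleftrightarrow> w = \<pi> j" for j w by auto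
  have "?P \<subseteq> {xs. length xs = ar2}" by auto
  then show ?l
    using \<pi>(1) X unfolding path_form_def sosat.simps(7)
    by (intro exI[of _ ?P] conjI) (simp_all add: P is_path_def kripke_of_def Eof_def Lof_def)
qed

text \<open>After the checks of the registers and of the structure, a table and a row set are
  guessed. The universal quantifier over \<open>VX\<close> makes the selected rows exactly the
  traces of the structure in the class.\<close>

definition fin_items :: "soform \<Rightarrow> item list" where
  "fin_items cf =
    [IAnd (Eq (TVar vm) (TTimes (TVar vn) (TVar vn))), IAnd (Eq (TVar vd) TZero),
     IAnd (Eq (TVar vl) TZero), IAnd (Eq (TVar vi) (TVar vn)), IAnd (Lt (TVar vr) (TVar vn)),
     IAnd (All1 va (SImp (Lt (TVar va) (TVar vn)) (Ex1 vb (SAnd (Lt (TVar vb) (TVar vn))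
       (M1 VE (TPlus (TTimes (TVar va) (TVar vn)) (TVar vb))))))),
     IEx2 VZ ar3, IEx2 VA ar1,
     IAnd (All2 VX ar2 (SIff (SAnd cf path_form)
       (Ex1 vu (SAnd (M1 VA (TVar vu)) (All1 vj (All1 vk
         (SIff (M2 VX (TVar vj) (TVar vk)) (M3 VZ (TVar vu) (TVar vj) (TVar vk)))))))))] @
    asg vs TZero"

text \<open>A preperiod, a period and the values before their sum determine the trace, and these
  values come from finitely many labels. Countability is what lets row numbers index the whole
  team.\<close>

lemma countable_ult_periodic:
  assumes "rel K \<subseteq> {..<nW K} \<times> {..<nW K}"
  shows "countable (team_of K \<inter> {t. ult_periodic t})"
proof -
  let ?T = "team_of K \<inter> {t. ult_periodic t}"
  let ?A = "lab K ` {..<nW K}"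
  have range: "t j \<in> ?A" if "t \<in> team_of K" for t j
  proof -
    obtain \<pi> where "is_path K \<pi>" and t: "t = (\<lambda>i. lab K (\<pi> i))"
      using \<open>t \<in> team_of K\<close> unfolding team_of_def by blast
    then have "(\<pi> j, \<pi> (Suc j)) \<in> rel K" by (simp add: is_path_def)
    then show ?thesis using assms t by auto
  qed
  define cd where "cd t = (SOME x. snd x > 0 \<and> (\<forall>n\<ge>fst x. t n = t (n + snd x)))" for t :: trace
  define f where "f t = (cd t, map t [0..<fst (cd t) + snd (cd t)])" for t :: trace
  have cd: "snd (cd t) > 0 \<and> (\<forall>n\<ge>fst (cd t). t n = t (n + snd (cd t)))" if "ult_periodic t" for t
  proof -
    from that obtain c d where "c > 0 \<and> d > 0 \<and> (\<forall>n\<ge>c. t n = t (n + d))"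
      unfolding ult_periodic_def by (elim exE)
    then have "snd (c, d) > 0 \<and> (\<forall>n\<ge>fst (c, d). t n = t (n + snd (c, d)))"
      unfolding fst_conv snd_conv by (rule conjunct2)
    then have "\<exists>x. snd x > 0 \<and> (\<forall>n\<ge>fst x. t n = t (n + snd x))" by (rule exI)
    from someI_ex[OF this] show ?thesis unfolding cd_def .
  qed
  have inj: "inj_on f ?T"
  proof (rule inj_onI, rule ext)
    fix t t' n
    assume t: "t \<in> ?T" and t': "t' \<in> ?T" and eq: "f t = f t'"
    obtain c d where cdt: "cd t = (c, d)" by fastforce
    then have cdt': "cd t' = (c, d)" using eq by (simp add: f_def)
    have "ult_periodic t" "ult_periodic t'" using t t' by simp_all
    then have d: "d > 0" and per: "\<forall>n\<ge>c. t n = t (n + d)" "\<forall>n\<ge>c. t' n = t' (n + d)"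
      using cd[of t] cd[of t'] unfolding cdt cdt' fst_conv snd_conv by iprover+
    have init: "t n = t' n" if "n < c + d" for n
    proof -
      have "map t [0..<c + d] = map t' [0..<c + d]" using eq cdt cdt' by (simp add: f_def)
      then show ?thesis using that by simp
    qed
    show "t n = t' n"
    proof (induction n rule: less_induct)
      case (less n)
      show ?case
      proof (cases "n < c + d")
        case False
        \<comment> \<open>One period back: still at least \<open>c\<close>, and smaller because
          \<open>d\<close> is positive.\<close>
        then have lt: "n - d < n" "c \<le> n - d" and n: "n - d + d = n" using d by auto
        show ?thesis using per[rule_format, OF lt(2)] less[OF lt(1)] unfolding n by simp
      qed (rule init)
    qed
  qed
  have "f t \<in> UNIV \<times> lists ?A" if "t \<in> ?T" for t
  proof -
    have "\<And>j. t j \<in> ?A" by (rule range[OF IntD1[OF that]])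
    then have "map t xs \<in> lists ?A" for xs unfolding in_lists_conv_set set_map by blast
    then show ?thesis unfolding f_def by (intro SigmaI UNIV_I)
  qed
  then have "f ` ?T \<subseteq> UNIV \<times> lists ?A" by (rule image_subsetI)
  moreover have "countable (UNIV \<times> lists ?A :: ((nat \<times> nat) \<times> nat set list) set)"
    by (intro countable_SIGMA countable_lists) (simp_all add: countable_finite)
  ultimately have "countable (f ` ?T)" by (rule countable_subset)
  then show ?thesis using inj by (rule countable_image_inj_on)
qed

section \<open>The reduction for a definable class of ultimately periodic traces\<close>

context
  fixes cf :: soform and C :: "trace \<Rightarrow> bool"
  assumes cf: "\<And>v V. sosat v V cf \<longleftrightarrow> C (dec (V VX ar2))"
    and fv_cf: "fv1 cf = {}" "fv2 cf = {(VX, ar2)}"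
    and C_periodic: "\<And>t. C t \<Longrightarrow> ult_periodic t"
begin

lemma fv_fin:
  assumes "fv1 h \<subseteq> {vs}" "fv2 h \<subseteq> {(VA, ar1), (VZ, ar3)}"
  shows "fv1 (app (fin_items cf) h) \<subseteq> {vn, vr, vm, vx, vd, vl, vi, vp}"
    "fv2 (app (fin_items cf) h) \<subseteq> {(VE, ar1), (VL, ar2)}"
  using assms by (auto simp: fin_items_def path_form_def fv_asg fv_cf)

text \<open>Every trace is \<open>dec S\<close> for some \<open>S\<close>, so quantifying over
  relations compares two sets of traces.\<close>

lemma table_form:
  "(\<forall>S. S \<subseteq> {xs. length xs = ar2} \<longrightarrow> (C (dec S) \<and> dec S \<in> T \<longleftrightarrow>
      (\<exists>c. [c] \<in> A \<and> (\<forall>j p. [j, p] \<in> S \<longleftrightarrow> [c, j, p] \<in> Z)))) \<longleftrightarrow>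
    row Z ` {c. [c] \<in> A} = T \<inter> {t. C t}" (is "?l \<longleftrightarrow> ?r")
proof -
  have "(\<forall>j p. [j, p] \<in> S \<longleftrightarrow> [c, j, p] \<in> Z) \<longleftrightarrow> dec S = row Z c" for S c
    by (auto simp: dec_def row_def fun_eq_iff)
  then have "?l \<longleftrightarrow> (\<forall>S. S \<subseteq> {xs. length xs = ar2} \<longrightarrow>
      (dec S \<in> T \<inter> {t. C t} \<longleftrightarrow> dec S \<in> row Z ` {c. [c] \<in> A}))"
    by (simp add: image_iff conj_commute Bex_def)
  also have "\<dots> \<longleftrightarrow> ?r" using dec_surj by (metis set_eqI)
  finally show ?thesis .
qed

text \<open>Some table lists the team by countability, and all correct tables represent the same
  team, so the guess of the table can be eliminated.\<close>

lemma sosat_fin: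
  fixes v V
  defines "K \<equiv> kripke_of (Eof V) (Lof V) (v vn) (v vr)"
  assumes "\<forall>j<v vn. finite {p. Lof V j p}"
  shows "sosat v V (app (fin_items cf) (tr \<phi>)) \<longleftrightarrow>
    v vm = v vn * v vn \<and> v vd = 0 \<and> v vl = 0 \<and> v vi = v vn \<and> wf_kripke K \<and>
    tsat (team_of K \<inter> {t. C t}) \<phi>"
proof -
  let ?T = "team_of K"
  have wf: "wf_kripke K \<longleftrightarrow> v vr < v vn \<and> (\<forall>a<v vn. \<exists>b<v vn. [a * v vn + b] \<in> V VE ar1)"
    using assms(2) by (auto simp: K_def wf_kripke_def kripke_of_def Eof_def)
  have "countable (?T \<inter> {t. ult_periodic t})"
    by (intro countable_ult_periodic) (auto simp: K_def kripke_of_def)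
  then have count: "countable (?T \<inter> {t. C t})"
    by (rule countable_subset[rotated]) (use C_periodic in auto)
  have ex: "\<exists>Z A. Z \<subseteq> {xs. length xs = ar3} \<and> A \<subseteq> {xs. length xs = ar1} \<and>
      row Z ` {c. [c] \<in> A} = ?T \<inter> {t. C t}"
  proof -
    let ?f = "from_nat_into (?T \<inter> {t. C t})"
    let ?Z = "{[c, j, p] | c j p. p \<in> ?f c j}"
    \<comment> \<open>An enumeration needs a nonempty team; the empty team gets no rows.\<close>
    let ?A = "{[c] | c. ?T \<inter> {t. C t} \<noteq> {}}"
    have "row ?Z = ?f" by (auto simp: row_def)
    then have "row ?Z ` {c. [c] \<in> ?A} = ?T \<inter> {t. C t}"
      using range_from_nat_into[OF _ count] by (cases "?T \<inter> {t. C t} = {}") auto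
    moreover have "?Z \<subseteq> {xs. length xs = ar3}" "?A \<subseteq> {xs. length xs = ar1}" by auto
    ultimately show ?thesis by blast
  qed
  have "sosat v V (app (fin_items cf) (tr \<phi>)) \<longleftrightarrow>
      v vm = v vn * v vn \<and> v vd = 0 \<and> v vl = 0 \<and> v vi = v vn \<and> wf_kripke K \<and>
      (\<exists>Z. Z \<subseteq> {xs. length xs = ar3} \<and> (\<exists>A. A \<subseteq> {xs. length xs = ar1} \<and>
        row Z ` {c. [c] \<in> A} = ?T \<inter> {t. C t} \<and> tsat (row Z ` {c. [c] \<in> A}) \<phi>))"
    unfolding wf table_form[symmetric]
    by (simp add: fin_items_def cf sosat_path_form sosat_tr team_def suffix_def K_def Eof_def[abs_def] Lof_def[abs_def])
  also have "\<dots> \<longleftrightarrow> v vm = v vn * v vn \<and> v vd = 0 \<and> v vl = 0 \<and> v vi = v vn \<and> wf_kripke K \<and>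
      tsat (?T \<inter> {t. C t}) \<phi>" using ex by metis
  finally show ?thesis .
qed

text \<open>From a true sentence, the guessed matrix and labelling define the structure, and
  soundness of the reader shows that \<open>u\<close> is its code. Conversely the matrix and
  labelling of a given structure are guessed, and completeness applies.\<close>

lemma true_sentence:
  assumes "list_all ktok u" "kph 3 u = 5"
  shows "true_so (app (pre @ kits kits1 3 u @ fin_items cf) (tr \<phi>)) \<longleftrightarrow>
    (\<exists>K. wf_kripke K \<and> enc_kripke K = 13 # u \<and> tsat (team_of K \<inter> {t. C t}) \<phi>)" (is "?l \<longleftrightarrow> ?r")
proof
  assume ?l
  then obtain S S' where "sosat (\<lambda>_. 0) ((\<lambda>_ _. {})(VE := (\<lambda>_. {})(ar1 := S), VL := (\<lambda>_. {})(ar2 := S')))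
      (app (kits kits1 3 u) (app (fin_items cf) (tr \<phi>)))"
    unfolding true_so_def app_append sosat_pre by (auto simp: fun_upd_idem)
  then obtain V where sat: "sosat (\<lambda>_. 0) V (app (kits kits1 3 u) (app (fin_items cf) (tr \<phi>)))" by blast
  have "case krun (Eof V) (Lof V) 3 u (st (\<lambda>_. 0)) of
      None \<Rightarrow> \<forall>h. \<not> sosat (\<lambda>_. 0) V (app (kits kits1 3 u) h)
    | Some (p', s) \<Rightarrow> \<exists>v'. st v' = s \<and> (\<forall>h. sosat (\<lambda>_. 0) V (app (kits kits1 3 u) h) = sosat v' V h)"
    using assms by (intro sosat_kits) auto
  moreover from this sat obtain p' s where run0: "krun (Eof V) (Lof V) 3 u (st (\<lambda>_. 0)) = Some (p', s)"
    by (cases "krun (Eof V) (Lof V) 3 u (st (\<lambda>_. 0))") auto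
  ultimately obtain v' where "st v' = s"
    and "\<forall>h. sosat (\<lambda>_. 0) V (app (kits kits1 3 u) h) = sosat v' V h"
    by (simp only: run0 option.case prod.case) blast
  then have run: "krun (Eof V) (Lof V) 3 u (st (\<lambda>_. 0)) = Some (p', st v')"
    and sat': "sosat v' V (app (fin_items cf) (tr \<phi>))"
    using sat run0 by simp_all
  \<comment> \<open>The phase depends on the input alone, not on the guess.\<close>
  have "p' = 5" using krun_kph[OF run] assms(2) by simp
  have *: "v' vm = v' vn * v' vn \<and> v' vd = 0 \<and> v' vl = 0 \<and> v' vi = v' vn"
    using sat' by (simp add: fin_items_def)
  then have code: "u = kcode (Eof V) (Lof V) (v' vn) (v' vr)" "\<forall>j<v' vn. finite {p. Lof V j p}"
    using krun_sound_code[OF assms(1), of "Eof V" "Lof V" "v' vn" "v' vr" "v' vx" "v' vp"] run \<open>p' = 5\<close>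
    by (simp_all add: st_def)
  let ?K = "kripke_of (Eof V) (Lof V) (v' vn) (v' vr)"
  have "wf_kripke ?K \<and> tsat (team_of ?K \<inter> {t. C t}) \<phi>"
    using sat' unfolding sosat_fin[of v' V, OF code(2)] by blast
  moreover have "enc_kripke ?K = 13 # u" unfolding code(1) by (rule enc_kripke_of)
  ultimately show ?r by blast
next
  assume ?r
  then obtain K where K: "wf_kripke K" "enc_kripke K = 13 # u" "tsat (team_of K \<inter> {t. C t}) \<phi>" by blast
  obtain E L where EL: "kripke_of E L (nW K) (rt K) = K"
    and fin: "\<forall>j<nW K. finite {p. L j p}" using kripke_of_surj[OF K(1)] .
  define S where "S = {[k] | k. E k}"
  define S' where "S' = {[i, p] | i p. L i p}"
  define V :: "nat \<Rightarrow> nat \<Rightarrow> nat list set"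
    where "V = (\<lambda>_ _. {})(VE := (\<lambda>_. {})(ar1 := S), VL := (\<lambda>_. {})(ar2 := S'))"
  have V: "Eof V = E" "Lof V = L" by (auto simp: Eof_def Lof_def S_def S'_def V_def fun_eq_iff)
  have u: "u = kcode E L (nW K) (rt K)" using enc_kripke_of[of E L "nW K" "rt K"] K(2) unfolding EL by simp
  have "krun E L 3 u (st (\<lambda>_. 0)) = Some (5, nW K, rt K, nW K * nW K, 0, 0, 0, nW K, nW K)"
    unfolding u using krun_complete[OF fin] by (simp add: st_def)
  then obtain v' where v': "st v' = (nW K, rt K, nW K * nW K, 0, 0, 0, nW K, nW K)"
    "\<forall>h. sosat (\<lambda>_. 0) V (app (kits kits1 3 u) h) = sosat v' V h"
    using sosat_kits[OF assms(1), of 3 "\<lambda>_. 0" V] unfolding V by auto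
  have "sosat v' V (app (fin_items cf) (tr \<phi>))"
    using sosat_fin[of v' V \<phi>] v'(1) V fin EL K by (simp add: st_def)
  then have "sosat (\<lambda>_. 0) V (app (kits kits1 3 u) (app (fin_items cf) (tr \<phi>)))" using v'(2) by simp
  moreover have "S \<subseteq> {xs. length xs = ar1}" "S' \<subseteq> {xs. length xs = ar2}"
    by (auto simp: S_def S'_def)
  ultimately show ?l unfolding true_so_def app_append sosat_pre V_def
    by (intro exI[of _ S] exI[of _ S'] conjI) (simp_all add: fun_upd_idem)
qed

lemma closed_sentence: "closed_so (app (pre @ kits kits1 3 u @ fin_items cf) (tr \<phi>))"
proof -
  have "fv1 (tr \<phi>) \<subseteq> {vs}" "fv2 (tr \<phi>) \<subseteq> {(VA, ar1), (VZ, ar3)}" using fv_tr by auto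
  note fv_kits[OF fv_fin[OF this], of 3 u]
  then show ?thesis by (auto simp: closed_so_def fv_pre)
qed

lemma reducible:
  "logspace_reducible
    {enc_instance K \<phi> | K \<phi>. wf_kripke K \<and> tsat (team_of K \<inter> {t. C t}) \<phi>} Delta20"
proof -
  let ?f = "\<lambda>w. trun (out pre kits1 (fin_items cf)) nxt 0 (16 # w @ [17])"
  obtain M where M: "logspace_computes M 1 ?f" using computes by blast
  have "w \<in> {enc_instance K \<phi> | K \<phi>. wf_kripke K \<and> tsat (team_of K \<inter> {t. C t}) \<phi>} \<longleftrightarrow> ?f w \<in> Delta20"
    (is "?l \<longleftrightarrow> ?r") if w: "set w \<subseteq> {..<16}" for w
  proof
    assume ?l
    then obtain K \<phi> where K: "wf_kripke K" "tsat (team_of K \<inter> {t. C t}) \<phi>"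
      and weq: "w = enc_kripke K @ enc_ltl \<phi>" unfolding enc_instance_def by blast
    obtain E L where EL: "kripke_of E L (nW K) (rt K) = K"
    and fin: "\<forall>j<nW K. finite {p. L j p}" using kripke_of_surj[OF K(1)] .
    define u where "u = kcode E L (nW K) (rt K)"
    have enc: "enc_kripke K = 13 # u" unfolding u_def enc_kripke_of[symmetric] EL ..
    have u: "list_all ktok u" "kph 3 u = 5"
      unfolding u_def by (rule ktok_kcode, rule krun_kph[OF krun_complete[OF fin]])
    have "?f w = enc_so (app (pre @ kits kits1 3 u @ fin_items cf) (tr \<phi>))"
      using transduce[OF u, of pre kits1 "fin_items cf" \<phi>] weq enc by simp
    moreover have "true_so (app (pre @ kits kits1 3 u @ fin_items cf) (tr \<phi>))"
      using true_sentence[OF u] K enc by blast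
    ultimately show ?r using closed_sentence unfolding Delta20_def by blast
  next
    assume ?r
    then obtain \<chi> where \<chi>: "?f w = enc_so \<chi>" "true_so \<chi>" unfolding Delta20_def by blast
    obtain u \<phi> where u: "list_all ktok u" "kph 3 u = 5" and weq: "w = 13 # u @ enc_ltl \<phi>"
      using transduce_wellformed[OF w \<chi>(1)] by blast
    have "?f w = enc_so (app (pre @ kits kits1 3 u @ fin_items cf) (tr \<phi>))"
      using transduce[OF u, of pre kits1 "fin_items cf" \<phi>] weq by simp
    \<comment> \<open>The empty remainders bring the equation into the form of unique
      readability.\<close>
    then have "enc_so \<chi> @ [] = enc_so (app (pre @ kits kits1 3 u @ fin_items cf) (tr \<phi>)) @ []"
      unfolding \<chi>(1) by (rule arg_cong)
    then have "\<chi> = app (pre @ kits kits1 3 u @ fin_items cf) (tr \<phi>)"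
      unfolding enc_so_prefix by simp
    then obtain K where K: "wf_kripke K" "enc_kripke K = 13 # u" "tsat (team_of K \<inter> {t. C t}) \<phi>"
      using true_sentence[OF u] \<chi>(2) by blast
    have "w = enc_instance K \<phi>" using K(2) weq by (simp add: enc_instance_def)
    then show ?l using K by blast
  qed
  then show ?thesis using M unfolding logspace_reducible_def by blast
qed

end

section \<open>Defining the two classes of traces\<close>

definition periodic_form :: soform where
  "periodic_form = Ex1 va (Ex1 vb (SAnd (Lt TZero (TVar va)) (SAnd (Lt TZero (TVar vb))
    (All1 vj (SImp (Le (TVar va) (TVar vj)) (All1 vk
      (SIff (M2 VX (TVar vj) (TVar vk)) (M2 VX (TPlus (TVar vj) (TVar vb)) (TVar vk)))))))))"

definition constant_form :: soform where
  "constant_form = Ex1 va (All1 vj (All1 vk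
    (SIff (M2 VX (TPlus (TVar va) (TVar vj)) (TVar vk)) (M2 VX (TVar va) (TVar vk)))))"

lemma ult_constant_periodic:
  assumes "ult_constant t"
  shows "ult_periodic t"
proof -
  obtain i where i: "\<And>n. t (i + n) = t i" using assms by (auto simp: ult_constant_def suffix_def)
  \<comment> \<open>Period 1; the start is \<open>i + 1\<close> because the threshold in
    \<open>ult_periodic\<close> must be positive.\<close>
  have "t n = t (n + 1)" if "i + 1 \<le> n" for n
    using i[of "n - i"] i[of "n + 1 - i"] that by simp
  then show ?thesis unfolding ult_periodic_def by (metis add_gr_0 zero_less_one)
qed

theorem mainTheorem13:
  shows "logspace_reducible UP_MC Delta20 \<and> logspace_reducible UC_MC Delta20"
proof
  show "logspace_reducible UP_MC Delta20"
    unfolding UP_MC_def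
    by (rule reducible[of periodic_form])
      (auto simp: periodic_form_def ult_periodic_def dec_def set_eq_iff)
  show "logspace_reducible UC_MC Delta20"
    unfolding UC_MC_def
    by (rule reducible[of constant_form])
      (auto simp: constant_form_def ult_constant_def suffix_def dec_def set_eq_iff ult_constant_periodic)
qed

end
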